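(* Let $r>1$ be an integer, $1\leqslant p<2$, and let $\{X_{n},\,n\geqslant 1\}$ be a sequence of random variables stochastically dominated by a random variable $X$ with $\mathbb{E}\lvert X\rvert^{p}<\infty$. If, for some $\alpha$ with $p<\alpha<2$, $$\sum_{1\leqslant i<j<\infty}\ \sum_{k=1}^{\infty} r^{(2/\alpha-2/p)k-2(k\vee\log_{r}j)/\alpha}\left[G_{X_{i},X_{j}}^{+}\big(r^{(k-1)/p}\big)+H_{X_{i},X_{j}}^{+}\big(r^{(k-1)/p},r^{k/p}\big)\right]<\infty,$$ then $$\frac{1}{n^{1/p}}\sum_{k=1}^{n}(X_{k}-\mathbb{E} X_{k})\longrightarrow 0\quad\text{almost surely as } n\to\infty.$$
   Context: Notation: $x\wedge y=\min\{x,y\}$, $x\vee y=\max\{x,y\}$, $x^{+}=0\vee x$; $G^{+}$ and $H^{+}$ denote the positive parts of the quantities $G$ and $H$ below. The outer sum runs over all pairs of positive integers $i<j$. No dependence structure is assumed on the random variables. A sequence $\{X_{n},\,n\geqslant 1\}$ of random variables is stochastically dominated by a random variable $X$ if there is a constant $C>0$ such that $\sup_{n\geqslant 1}\mathbb{P}\{\lvert X_{n}\rvert>t\}\leqslant C\,\mathbb{P}\{\lvert X\rvert>t\}$ for all $t>0$. For real numbers $0<L\leqslant K$, define the truncation $g_{L}(t)=(t\wedge L)\vee(-L)$ and $h_{L,K}(t)=\lvert g_{K}(t)-g_{L}(t)\rvert$. For random variables $X,Y$, define $$G_{X,Y}(L):=\mathrm{Cov}\big(g_{L}(X),g_{L}(Y)\big),\qquad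 H_{X,Y}(L,K):=\mathrm{Cov}\big(h_{L,K}(X),h_{L,K}(Y)\big).$$ *)

theory Defs
  imports "HOL-Probability.Probability"
begin

definition covariance :: "'a measure \<Rightarrow> ('a \<Rightarrow> real) \<Rightarrow> ('a \<Rightarrow> real) \<Rightarrow> real" where
  "covariance M U V =
     (\<integral>\<omega>. (U \<omega> - (\<integral>\<omega>'. U \<omega>' \<partial>M)) * (V \<omega> - (\<integral>\<omega>'. V \<omega>' \<partial>M)) \<partial>M)"

text \<open>Sequences are indexed from 1: the value at index 0 is never constrained.\<close>

definition stochastically_dominated ::
    "'a measure \<Rightarrow> (nat \<Rightarrow> 'a \<Rightarrow> real) \<Rightarrow> ('a \<Rightarrow> real) \<Rightarrow> bool" where
  "stochastically_dominated M X Y \<longleftrightarrow>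
     (\<exists>C>0. \<forall>t>0. (SUP n\<in>{1..}. measure M {\<omega> \<in> space M. \<bar>X n \<omega>\<bar> > t})
                  \<le> C * measure M {\<omega> \<in> space M. \<bar>Y \<omega>\<bar> > t})"

definition trunc :: "real \<Rightarrow> real \<Rightarrow> real" where
  "trunc L t = max (min t L) (- L)"

definition trunc_diff :: "real \<Rightarrow> real \<Rightarrow> real \<Rightarrow> real" where
  "trunc_diff L K t = \<bar>trunc K t - trunc L t\<bar>"

definition G_cov :: "'a measure \<Rightarrow> ('a \<Rightarrow> real) \<Rightarrow> ('a \<Rightarrow> real) \<Rightarrow> real \<Rightarrow> real" where
  "G_cov M U V L = covariance M (\<lambda>\<omega>. trunc L (U \<omega>)) (\<lambda>\<omega>. trunc L (V \<omega>))"

definition H_cov ::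
    "'a measure \<Rightarrow> ('a \<Rightarrow> real) \<Rightarrow> ('a \<Rightarrow> real) \<Rightarrow> real \<Rightarrow> real \<Rightarrow> real" where
  "H_cov M U V L K =
     covariance M (\<lambda>\<omega>. trunc_diff L K (U \<omega>)) (\<lambda>\<omega>. trunc_diff L K (V \<omega>))"

end

theory Submission
  imports Defs
begin

text \<open>
  Write \<open>L\<^sub>k = r powr (k/p)\<close> and let \<open>S\<^sub>k n\<close> be the centred partial sum up to \<open>n\<close> of the variables
  truncated at \<open>L\<^sub>k\<close>. It suffices to bound the sums for all \<open>n < r ^ m\<close> at once by \<open>o(L\<^sub>m)\<close> as
  \<open>m\<close> grows. Replacing the variables by their truncations at \<open>L\<^sub>m\<close> costs nothing: almost surely, for
  all large \<open>m\<close>, none of the first \<open>r ^ m\<close> variables exceeds \<open>L\<^sub>m\<close>, and the means change by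
  \<open>o(L\<^sub>m)\<close> in total.

  No dependence structure is available, so there is no maximal inequality to quote. The maximum over \<open>n\<close>
  is handled by chaining over both the index and the truncation level. Let \<open>n\<^sub>k\<close> be \<open>n\<close> rounded down to
  a multiple of \<open>r ^ k\<close>, so that \<open>n\<^sub>0 = n\<close> and \<open>n\<^sub>m = 0\<close>. Then
  \[ S_m(n) = \sum_{k<m} \big( (S_k(n_k) - S_k(n_{k+1}))
       + ((S_{k+1} - S_k)(n) - (S_{k+1} - S_k)(n_{k+1})) \big). \]
  The first bracket is a sum over one of at most \<open>r ^ (m - k)\<close> short blocks. The second runs over an
  incomplete block, but its terms are dominated by the nonnegative layers
  \<open>trunc_diff L\<^sub>k L\<^sub>k\<^sub>+\<^sub>1 X\<^sub>i\<close> and their means, so it is at most a sum of centred layers over a complete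
  block plus a bias (\<open>partial_sum_le_block_energies\<close>). This is why exactly the covariances of
  truncations and of layers enter. Bounding a maximum of squares by the sum of the squares over all blocks
  (\<open>block_energy\<close>), the expectation is controlled by the diagonal second moments and the positive
  parts of the covariances (\<open>expected_block_energy_le\<close>).

  The scales are combined by the Cauchy-Schwarz inequality with weights \<open>r powr ((2/p - 2/\<alpha>) k)\<close>, so
  that it remains to show that
  \<open>r powr (- 2m/\<alpha>) * (\<Sum>k<m. r powr (- (2/p - 2/\<alpha>) (k + 1)) * energy k m)\<close> has a bounded sum of
  expectations over \<open>m\<close>. In the off-diagonal part, a pair \<open>i < j\<close> at scale \<open>k\<close> appears only when
  \<open>m > k\<close> and \<open>r ^ m \<ge> j\<close>; the geometric sum over these \<open>m\<close> produces the weight of the hypothesis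
  (\<open>sum_off_diagonal_le\<close>). Because \<open>\<alpha> < 2\<close>, the diagonal part reduces to
  \<open>\<Sum>k. r powr ((1 - 2/p) k) * E (min \<bar>Y\<bar> L\<^sub>k)\<^sup>2\<close>, which is at most a multiple of
  \<open>E (\<bar>Y\<bar> powr p)\<close> since \<open>p < 2\<close>.
\<close>

section \<open>Geometric sums and geometric blocks\<close>

text \<open>
  Every interchange of a sum over scales with another sum rests on this: since the ratio is not 1, the terms
  decay geometrically away from the largest one, whichever end that is, so the constant depends neither on
  the set of exponents nor on the bound.
\<close>
lemma geometric_sum_le_largest_term:
  fixes R \<theta> :: real
  assumes "R > 1" "\<theta> \<noteq> 0"
  obtains c where "c > 0"
    "\<And>A B. \<lbrakk>finite A; 0 \<le> B; \<And>k. k \<in> A \<Longrightarrow> R powr (\<theta> * real k) \<le> B\<rbrakk>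
       \<Longrightarrow> (\<Sum>k\<in>A. R powr (\<theta> * real k)) \<le> c * B"
proof -
  define x where "x = R powr \<theta>"
  have x0: "x > 0" using assms by (simp add: x_def)
  have pow: "R powr (\<theta> * real k) = x ^ k" for k
    using x0 assms by (simp add: x_def powr_powr flip: powr_realpow)
  consider "x > 1" | "x < 1"
    using assms by (cases "\<theta> > 0") (auto simp: x_def powr_less_one)
  then show ?thesis
  proof cases
    case 1
    show ?thesis
    proof (rule that[of "x / (x - 1)"])
      show "x / (x - 1) > 0" using 1 by simp
      fix A B assume A: "finite A" "0 \<le> B" "\<And>k. k \<in> A \<Longrightarrow> R powr (\<theta> * real k) \<le> B"
      show "(\<Sum>k\<in>A. R powr (\<theta> * real k)) \<le> x / (x - 1) * B"
      proof (cases "A = {}")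
        case False
        have "(\<Sum>k\<in>A. R powr (\<theta> * real k)) \<le> (\<Sum>k<Suc (Max A). x ^ k)"
          unfolding pow using A x0 by (intro sum_mono2) (auto simp: less_Suc_eq_le)
        also have "\<dots> = (x ^ Suc (Max A) - 1) / (x - 1)"
          using 1 by (subst geometric_sum) auto
        also have "\<dots> \<le> x ^ Suc (Max A) / (x - 1)"
          using 1 by (intro divide_right_mono) auto
        also have "\<dots> = x / (x - 1) * R powr (\<theta> * real (Max A))"
          by (simp add: pow)
        also have "\<dots> \<le> x / (x - 1) * B"
          using 1 A False by (intro mult_left_mono) auto
        finally show ?thesis .
      qed (use 1 A in simp)
    qed
  next
    case 2
    show ?thesis
    proof (rule that[of "1 / (1 - x)"])
      show "1 / (1 - x) > 0" using 2 by simp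
      fix A B assume A: "finite A" "0 \<le> B" "\<And>k. k \<in> A \<Longrightarrow> R powr (\<theta> * real k) \<le> B"
      show "(\<Sum>k\<in>A. R powr (\<theta> * real k)) \<le> 1 / (1 - x) * B"
      proof (cases "A = {}")
        case False
        have "(\<Sum>k\<in>A. R powr (\<theta> * real k)) \<le> (\<Sum>k=Min A..Max A. x ^ k)"
          unfolding pow using A x0 by (intro sum_mono2) auto
        also have "\<dots> = (x ^ Min A - x ^ Suc (Max A)) / (1 - x)"
          using 2 A False by (subst sum_gp) (auto simp: not_less)
        also have "\<dots> \<le> x ^ Min A / (1 - x)"
          using 2 x0 by (intro divide_right_mono) auto
        also have "\<dots> = 1 / (1 - x) * R powr (\<theta> * real (Min A))"
          by (simp add: pow)
        also have "\<dots> \<le> 1 / (1 - x) * B"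
          using 2 A False by (intro mult_left_mono) auto
        finally show ?thesis .
      qed (use 2 A in simp)
    qed
  qed
qed

text \<open>
  The sum splits at the scale where \<open>R powr k\<close> passes \<open>y powr p\<close>. Below it the terms are
  \<open>R powr k\<close>, above it they are \<open>y\<^sup>2 * R powr ((1 - 2/p) k)\<close>; both are geometric and both have a largest
  term of order \<open>y powr p\<close> at the split.
\<close>
lemma sum_truncated_squares_le_powr:
  fixes R p :: real
  assumes "R > 1" "0 < p" "p < 2"
  obtains c where "c > 0"
    "\<And>y N. 0 \<le> y \<Longrightarrow>
       (\<Sum>k<N. R powr ((1 - 2 / p) * real k) * (min y (R powr (real k / p)))\<^sup>2) \<le> c * y powr p"
proof -
  have "(1::real) \<noteq> 0" by simp
  from geometric_sum_le_largest_term[OF assms(1) this] obtain c1 where c1: "c1 > 0"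
    "\<And>A B. \<lbrakk>finite A; 0 \<le> B; \<And>k. k \<in> A \<Longrightarrow> R powr (1 * real k) \<le> B\<rbrakk>
       \<Longrightarrow> (\<Sum>k\<in>A. R powr (1 * real k)) \<le> c1 * B" by blast
  have "1 - 2 / p \<noteq> 0" using assms by (simp add: field_simps)
  from geometric_sum_le_largest_term[OF assms(1) this] obtain c2 where c2: "c2 > 0"
    "\<And>A B. \<lbrakk>finite A; 0 \<le> B; \<And>k. k \<in> A \<Longrightarrow> R powr ((1 - 2 / p) * real k) \<le> B\<rbrakk>
       \<Longrightarrow> (\<Sum>k\<in>A. R powr ((1 - 2 / p) * real k)) \<le> c2 * B" by blast
  show ?thesis
  proof (rule that[of "c1 + c2"])
    fix y :: real and N :: nat assume y: "0 \<le> y"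
    let ?L = "\<lambda>k::nat. R powr (real k / p)"
    let ?f = "\<lambda>k::nat. R powr ((1 - 2 / p) * real k) * (min y (?L k))\<^sup>2"
    \<comment> \<open>The scales at which the truncation cuts \<open>y\<close>, and those at which it does not.\<close>
    define I J where "I = {k. k < N \<and> ?L k \<le> y}" and "J = {k. k < N \<and> y < ?L k}"
    have IJ: "finite I" "finite J" "{..<N} = I \<union> J" "I \<inter> J = {}"
      by (auto simp: I_def J_def)
    have Lp: "(?L k) powr p = R powr real k" for k
      using assms by (simp add: powr_powr)
    have L2: "(?L k)\<^sup>2 = R powr ((2 / p) * real k)" for k
      using assms by (simp add: powr_powr field_simps flip: powr_numeral)
    have "(\<Sum>k\<in>I. ?f k) = (\<Sum>k\<in>I. R powr (1 * real k))"
    proof (intro sum.cong refl)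
      fix k assume "k \<in> I"
      then have "min y (?L k) = ?L k" by (auto simp: I_def)
      then have "?f k = R powr ((1 - 2 / p) * real k) * R powr ((2 / p) * real k)"
        by (simp add: L2)
      also have "\<dots> = R powr (1 * real k)"
        by (simp add: algebra_simps flip: powr_add)
      finally show "?f k = R powr (1 * real k)" .
    qed
    also have "\<dots> \<le> c1 * y powr p"
    proof (rule c1(2))
      fix k assume "k \<in> I"
      then have "(?L k) powr p \<le> y powr p" using assms by (intro powr_mono2) (auto simp: I_def)
      then show "R powr (1 * real k) \<le> y powr p" by (simp add: Lp)
    qed (use IJ in auto)
    finally have I: "(\<Sum>k\<in>I. ?f k) \<le> c1 * y powr p" .
    have J: "(\<Sum>k\<in>J. ?f k) \<le> c2 * y powr p"
    proof (cases "y = 0")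
      case False
      with y have y: "y > 0" by simp
      have "(\<Sum>k\<in>J. ?f k) = y\<^sup>2 * (\<Sum>k\<in>J. R powr ((1 - 2 / p) * real k))"
        unfolding sum_distrib_left by (intro sum.cong) (auto simp: J_def)
      also have "\<dots> \<le> y\<^sup>2 * (c2 * y powr (p - 2))"
      proof (intro mult_left_mono c2(2))
        fix k assume "k \<in> J"
        then have "(?L k) powr (p - 2) \<le> y powr (p - 2)"
          using assms y by (intro powr_mono2') (auto simp: J_def)
        also have "(?L k) powr (p - 2) = R powr ((1 - 2 / p) * real k)"
          using assms by (simp add: powr_powr field_simps)
        finally show "R powr ((1 - 2 / p) * real k) \<le> y powr (p - 2)" .
      qed (use IJ in auto)
      also have "\<dots> = c2 * (y powr 2 * y powr (p - 2))" using y by simp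
      also have "\<dots> = c2 * y powr p" by (simp flip: powr_add)
      finally show ?thesis .
    qed auto
    have "(\<Sum>k<N. ?f k) = (\<Sum>k\<in>I. ?f k) + (\<Sum>k\<in>J. ?f k)"
      using IJ by (simp add: sum.union_disjoint)
    with I J show "(\<Sum>k<N. ?f k) \<le> (c1 + c2) * y powr p" by (simp add: algebra_simps)
  qed (use c1 c2 in simp)
qed

text \<open>
  Used for the accumulated biases: the bias at scale \<open>k\<close> counts at scale \<open>m\<close> with a factor
  decaying geometrically in \<open>m - k\<close>. Convergence holds term by term, with a geometric majorant.
\<close>
lemma geometric_convolution_tendsto_zero:
  fixes x :: real and e :: "nat \<Rightarrow> real"
  assumes x: "0 \<le> x" "x < 1" and e: "e \<longlonglongrightarrow> 0"
  shows "(\<lambda>m. \<Sum>k<m. x ^ (m - k) * e k) \<longlonglongrightarrow> 0"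
proof -
  obtain E where E: "\<And>k. \<bar>e k\<bar> \<le> E"
    using convergent_imp_Bseq[of e] e by (auto simp: convergent_def Bseq_def)
  let ?f = "\<lambda>j m. if j < m then x ^ Suc j * e (m - Suc j) else 0"
  have "(\<lambda>m. \<Sum>j. ?f j m) \<longlonglongrightarrow> (\<Sum>j::nat. 0)"
  proof (rule tannerys_theorem[where M = "\<lambda>j. x ^ Suc j * E", THEN conjunct2, THEN conjunct2])
    show "(?f j \<longlongrightarrow> 0) sequentially" for j
    proof -
      have "(\<lambda>m. x ^ Suc j * e (m - Suc j)) \<longlonglongrightarrow> x ^ Suc j * 0"
        by (intro tendsto_mult tendsto_const seq_offset_neg e)
      then have "(\<lambda>m. x ^ Suc j * e (m - Suc j)) \<longlonglongrightarrow> 0" by simp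
      then show ?thesis
        by (rule Lim_transform_eventually)
           (use eventually_gt_at_top[of j] in eventually_elim, simp)
    qed
    show "\<forall>\<^sub>F (k, n) in at_top \<times>\<^sub>F sequentially. norm (?f k n) \<le> x ^ Suc k * E"
    proof (intro always_eventually allI, clarify)
      fix j m
      have "0 \<le> E" using E[of 0] by simp
      then show "norm (?f j m) \<le> x ^ Suc j * E"
        using x E[of "m - Suc j"] by (auto simp: abs_mult simp del: power_Suc intro!: mult_left_mono)
    qed
    show "summable (\<lambda>j. x ^ Suc j * E)"
      using x by (intro summable_mult2) (simp add: summable_mult)
  qed auto
  moreover have "(\<Sum>j. ?f j m) = (\<Sum>k<m. x ^ (m - k) * e k)" for m
  proof -
    have "(\<Sum>j. ?f j m) = (\<Sum>j<m. x ^ Suc j * e (m - Suc j))"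
      by (subst suminf_finite[of "{..<m}"]) (auto simp del: power_Suc)
    also have "\<dots> = (\<Sum>k<m. x ^ (m - k) * e k)"
      by (subst sum.nat_diff_reindex[symmetric]) (auto intro!: sum.cong simp del: power_Suc simp: Suc_diff_Suc)
    finally show ?thesis .
  qed
  ultimately show ?thesis by simp
qed

text \<open>
  Within \<open>r ^ (m - 1) \<le> n < r ^ m\<close> the normalisations \<open>n powr (1/p)\<close> and \<open>r powr (m/p)\<close> differ by
  a factor of at most \<open>r powr (1/p)\<close>, so a bound that is uniform over each block suffices.
\<close>
lemma geometric_blocks_tendsto_zero:
  fixes S U :: "nat \<Rightarrow> real" and r :: nat and p :: real
  assumes r: "r > 1" and p: "p > 0" and U: "U \<longlonglongrightarrow> 0"
    and S: "eventually (\<lambda>m. \<forall>n\<ge>1. n < r ^ m \<longrightarrow> \<bar>S n\<bar> \<le> real r powr (real m / p) * U m) sequentially"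
  shows "(\<lambda>n. 1 / real n powr (1 / p) * S n) \<longlonglongrightarrow> 0"
proof -
  define m where "m n = Suc (SOME k. r ^ k \<le> n \<and> n < r ^ (k + 1))" for n
  have m: "r ^ (m n - 1) \<le> n \<and> n < r ^ m n \<and> m n \<ge> 1" if "n \<ge> 1" for n
    using someI_ex[OF ex_power_ivl1[of r n]] r that by (simp add: m_def)
  have m_top: "filterlim m at_top sequentially"
    unfolding filterlim_at_top
  proof
    fix K
    show "\<forall>\<^sub>F n in sequentially. K \<le> m n"
      using eventually_ge_at_top[of "r ^ K"]
    proof eventually_elim
      case (elim n)
      moreover have "(1::nat) \<le> r ^ K" using r by simp
      ultimately have "n \<ge> 1" by linarith
      with m[of n] elim have "r ^ K < r ^ m n" by auto
      with r show ?case by (simp add: power_strict_increasing_iff)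
    qed
  qed
  have "(\<lambda>n. real r powr (1 / p) * U (m n)) \<longlonglongrightarrow> real r powr (1 / p) * 0"
    by (intro tendsto_intros filterlim_compose[OF U m_top])
  then have lim: "(\<lambda>n. real r powr (1 / p) * U (m n)) \<longlonglongrightarrow> 0" by simp
  show ?thesis
  proof (rule Lim_null_comparison[OF _ lim])
    have "\<forall>\<^sub>F n in sequentially. n \<ge> 1 \<and>
        (\<forall>n'\<ge>1. n' < r ^ m n \<longrightarrow> \<bar>S n'\<bar> \<le> real r powr (real (m n) / p) * U (m n))"
      using eventually_ge_at_top eventually_compose_filterlim[OF S m_top]
      by (rule eventually_conj)
    then show "\<forall>\<^sub>F n in sequentially. norm (1 / real n powr (1 / p) * S n) \<le> real r powr (1 / p) * U (m n)"
    proof eventually_elim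
      case (elim n)
      then have n: "n \<ge> 1" by simp
      have b: "\<bar>S n\<bar> \<le> real r powr (real (m n) / p) * U (m n)"
        using elim m[OF n] by blast
      have "0 \<le> real r powr (real (m n) / p) * U (m n)" using b by linarith
      then have U0: "U (m n) \<ge> 0" using r by (simp add: zero_le_mult_iff)
      have "real r powr (real (m n) / p) = (real r powr real (Suc (m n - 1))) powr (1 / p)"
        using m[OF n] by (simp add: powr_powr)
      also have "\<dots> = (real r * real (r ^ (m n - 1))) powr (1 / p)"
        using r by (subst powr_realpow) auto
      also have "\<dots> \<le> (real r * real n) powr (1 / p)"
        using m[OF n] r p by (intro powr_mono2 mult_left_mono) (auto simp del: of_nat_power)
      also have "\<dots> = real r powr (1 / p) * real n powr (1 / p)"
        by (simp add: powr_mult)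
      finally have "\<bar>S n\<bar> \<le> real r powr (1 / p) * real n powr (1 / p) * U (m n)"
        using b U0 by (meson mult_right_mono order_trans)
      with n show ?case by (simp add: field_simps)
    qed
  qed
qed

section \<open>Chaining along the expansion of an index in base r\<close>

text \<open>
  Chaining at scale \<open>k\<close> meets two kinds of index intervals below \<open>r ^ m\<close>: initial segments, made of fewer
  than \<open>r\<close> cells of length \<open>r ^ k\<close>, of an aligned block of length \<open>r ^ (k + 1)\<close>, and such blocks as a
  whole. The sum of the squares over all of them dominates the square of each, hence of their maximum.
\<close>
definition block_energy :: "nat \<Rightarrow> nat \<Rightarrow> nat \<Rightarrow> (nat \<Rightarrow> real) \<Rightarrow> (nat \<Rightarrow> real) \<Rightarrow> real" where
  "block_energy r k m f g =
     (\<Sum>b<r ^ (m - Suc k).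
        (\<Sum>s<r. (\<Sum>i\<in>{b * r ^ Suc k<..b * r ^ Suc k + s * r ^ k}. f i)\<^sup>2)
        + (\<Sum>i\<in>{b * r ^ Suc k<..Suc b * r ^ Suc k}. g i)\<^sup>2)"

text \<open>
  The telescoping of \<open>S\<^sub>k(n) - S\<^sub>k(n\<^sub>k)\<close> in \<open>k\<close>. The index is rounded more coarsely as the
  truncation level rises, which balances the number of blocks at a scale against the size of the
  truncated variables there.
\<close>
lemma chaining_identity:
  fixes T :: "nat \<Rightarrow> nat \<Rightarrow> real" and r n :: nat
  defines "c \<equiv> \<lambda>k. r ^ k * (n div r ^ k)"
  shows "(\<Sum>i\<in>{c m<..n}. T m i)
    = (\<Sum>k<m. (\<Sum>i\<in>{c (Suc k)<..c k}. T k i) + (\<Sum>i\<in>{c (Suc k)<..n}. T (Suc k) i - T k i))"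
proof (induction m)
  case (Suc m)
  have "c m \<le> n" by (simp add: c_def)
  moreover have "c (Suc m) \<le> c m"
  proof -
    have "c (Suc m) = r ^ m * (r * (n div r ^ m div r))"
      unfolding c_def power_Suc2 div_mult2_eq by (simp add: mult_ac)
    also have "\<dots> \<le> c m" unfolding c_def by (intro mult_left_mono) simp_all
    finally show ?thesis .
  qed
  ultimately have "{c (Suc m)<..n} = {c (Suc m)<..c m} \<union> {c m<..n}"
    by auto
  then have "(\<Sum>i\<in>{c (Suc m)<..n}. T m i) = (\<Sum>i\<in>{c (Suc m)<..c m}. T m i) + (\<Sum>i\<in>{c m<..n}. T m i)"
    by (simp add: sum.union_disjoint)
  then show ?case using Suc by (simp add: sum_subtractf)
qed (simp add: c_def)

lemma block_energy_nonneg: "block_energy r k m f g \<ge> 0"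
  unfolding block_energy_def by (intro sum_nonneg add_nonneg_nonneg) auto

lemma block_sums_le_block_energy:
  assumes "b < r ^ (m - Suc k)"
  shows "s < r \<Longrightarrow> \<bar>\<Sum>i\<in>{b * r ^ Suc k<..b * r ^ Suc k + s * r ^ k}. f i\<bar> \<le> sqrt (block_energy r k m f g)"
    and "\<bar>\<Sum>i\<in>{b * r ^ Suc k<..Suc b * r ^ Suc k}. g i\<bar> \<le> sqrt (block_energy r k m f g)"
proof -
  let ?F = "\<lambda>b s. (\<Sum>i\<in>{b * r ^ Suc k<..b * r ^ Suc k + s * r ^ k}. f i)\<^sup>2"
  let ?G = "\<lambda>b. (\<Sum>i\<in>{b * r ^ Suc k<..Suc b * r ^ Suc k}. g i)\<^sup>2"
  have b: "(\<Sum>s<r. ?F b s) + ?G b \<le> block_energy r k m f g"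
    unfolding block_energy_def using assms
    by (intro member_le_sum[where f = "\<lambda>b. (\<Sum>s<r. ?F b s) + ?G b"])
       (auto intro!: sum_nonneg add_nonneg_nonneg)
  have "0 \<le> (\<Sum>s<r. ?F b s)" by (intro sum_nonneg) auto
  with b have "?G b \<le> block_energy r k m f g" by linarith
  then show "\<bar>\<Sum>i\<in>{b * r ^ Suc k<..Suc b * r ^ Suc k}. g i\<bar> \<le> sqrt (block_energy r k m f g)"
    by (metis real_sqrt_abs real_sqrt_le_iff)
  assume "s < r"
  then have "?F b s \<le> (\<Sum>s<r. ?F b s)"
    by (intro member_le_sum[where f = "?F b"]) auto
  moreover have "0 \<le> ?G b" by simp
  ultimately have "?F b s \<le> block_energy r k m f g" using b by linarith
  then show "\<bar>\<Sum>i\<in>{b * r ^ Suc k<..b * r ^ Suc k + s * r ^ k}. f i\<bar> \<le> sqrt (block_energy r k m f g)"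
    by (metis real_sqrt_abs real_sqrt_le_iff)
qed

text \<open>
  The increments between consecutive levels are summed over an incomplete block, of which there would
  be too many to add up. Since their majorants \<open>D k i + c k\<close> are nonnegative, the block may be
  completed before the centred quantities are looked at.
\<close>
lemma partial_sum_le_block_energies:
  fixes T D :: "nat \<Rightarrow> nat \<Rightarrow> real" and c :: "nat \<Rightarrow> real"
  assumes r: "r > 1" and n: "n < r ^ m"
    and incr: "\<And>k i. i \<ge> 1 \<Longrightarrow> \<bar>T (Suc k) i - T k i\<bar> \<le> D k i + c k"
  shows "\<bar>\<Sum>i\<in>{0<..n}. T m i\<bar>
           \<le> (\<Sum>k<m. 2 * sqrt (block_energy r k m (T k) (D k)) + real (r ^ Suc k) * c k)"
proof -
  define d where "d k = r ^ k * (n div r ^ k)" for k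
  let ?Q = "\<lambda>k. sqrt (block_energy r k m (T k) (D k))"
  \<comment> \<open>The chain ends at 0 because \<open>n\<close> has no digit in position \<open>m\<close> or above.\<close>
  have "d m = 0" using n by (simp add: d_def)
  then have "\<bar>\<Sum>i\<in>{0<..n}. T m i\<bar> = \<bar>\<Sum>k<m. (\<Sum>i\<in>{d (Suc k)<..d k}. T k i) + (\<Sum>i\<in>{d (Suc k)<..n}. T (Suc k) i - T k i)\<bar>"
    using chaining_identity[where r = r and n = n and m = m and T = T] by (simp only: d_def)
  also have "\<dots> \<le> (\<Sum>k<m. \<bar>(\<Sum>i\<in>{d (Suc k)<..d k}. T k i) + (\<Sum>i\<in>{d (Suc k)<..n}. T (Suc k) i - T k i)\<bar>)"
    by (rule sum_abs)
  also have "\<dots> \<le> (\<Sum>k<m. 2 * ?Q k + real (r ^ Suc k) * c k)"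
  proof (rule sum_mono)
    fix k assume "k \<in> {..<m}"
    then have k: "Suc k \<le> m" by simp
    define b s where "b = n div r ^ Suc k" and "s = (n div r ^ k) mod r"
    have b: "b < r ^ (m - Suc k)"
    proof -
      have "r ^ m = r ^ (m - Suc k) * r ^ Suc k"
        using k by (metis le_add_diff_inverse2 power_add)
      with n show ?thesis unfolding b_def using r by (simp add: div_less_iff_less_mult)
    qed
    have s: "s < r" using r by (simp add: s_def)
    have b': "b = n div r ^ k div r"
      unfolding b_def power_Suc2 div_mult2_eq ..
    have d1: "d (Suc k) = b * r ^ Suc k" by (simp add: d_def b_def mult_ac)
    have "n div r ^ k = b * r + s" by (simp add: b' s_def)
    then have d0: "d k = b * r ^ Suc k + s * r ^ k"
      by (simp add: d_def algebra_simps)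
    have n_le: "n \<le> Suc b * r ^ Suc k"
    proof -
      have "n mod r ^ Suc k < r ^ Suc k" using r by simp
      moreover have "n = b * r ^ Suc k + n mod r ^ Suc k"
        unfolding b_def by (rule div_mult_mod_eq[symmetric])
      ultimately show ?thesis by (simp del: power_Suc)
    qed
    have "\<bar>\<Sum>i\<in>{d (Suc k)<..d k}. T k i\<bar> \<le> ?Q k"
      unfolding d1 d0 by (rule block_sums_le_block_energy(1)[OF b s])
    moreover have "\<bar>\<Sum>i\<in>{d (Suc k)<..n}. T (Suc k) i - T k i\<bar> \<le> ?Q k + real (r ^ Suc k) * c k"
    proof -
      have "\<bar>\<Sum>i\<in>{d (Suc k)<..n}. T (Suc k) i - T k i\<bar> \<le> (\<Sum>i\<in>{d (Suc k)<..n}. D k i + c k)"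
        by (rule order_trans[OF sum_abs], rule sum_mono, rule incr) auto
      also have "\<dots> \<le> (\<Sum>i\<in>{b * r ^ Suc k<..Suc b * r ^ Suc k}. D k i + c k)"
      proof (rule sum_mono2)
        show "0 \<le> D k i + c k" if "i \<in> {b * r ^ Suc k<..Suc b * r ^ Suc k} - {d (Suc k)<..n}" for i
          using incr[of i k] that by fastforce
      qed (use n_le d1 in auto)
      also have "\<dots> = (\<Sum>i\<in>{b * r ^ Suc k<..Suc b * r ^ Suc k}. D k i) + real (r ^ Suc k) * c k"
        by (simp add: sum.distrib del: power_Suc)
      also have "(\<Sum>i\<in>{b * r ^ Suc k<..Suc b * r ^ Suc k}. D k i) \<le> ?Q k"
        using block_sums_le_block_energy(2)[OF b, of "D k" "T k"] by linarith
      finally show ?thesis by simp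
    qed
    ultimately show "\<bar>(\<Sum>i\<in>{d (Suc k)<..d k}. T k i) + (\<Sum>i\<in>{d (Suc k)<..n}. T (Suc k) i - T k i)\<bar>
        \<le> 2 * ?Q k + real (r ^ Suc k) * c k" by linarith
  qed
  finally show ?thesis .
qed

text \<open>
  The Cauchy-Schwarz inequality with geometric weights. A growing weight makes the sum of the weights
  comparable to its last term, so that, unlike with equal weights, no factor \<open>m\<close> is lost.
\<close>
lemma square_sum_sqrt_le_weighted:
  fixes R \<gamma> :: real
  assumes "R > 1" "\<gamma> > 0"
  obtains c where "c > 0" "\<And>m Q. (\<And>k. Q k \<ge> 0) \<Longrightarrow>
     (\<Sum>k<m. sqrt (Q k))\<^sup>2 \<le> c * (R powr (\<gamma> * real m) * (\<Sum>k<m. R powr (- \<gamma> * real (Suc k)) * Q k))"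
proof -
  have "\<gamma> \<noteq> 0" using assms by simp
  from geometric_sum_le_largest_term[OF assms(1) this] obtain c where c: "c > 0"
    "\<And>A B. \<lbrakk>finite A; 0 \<le> B; \<And>k. k \<in> A \<Longrightarrow> R powr (\<gamma> * real k) \<le> B\<rbrakk>
       \<Longrightarrow> (\<Sum>k\<in>A. R powr (\<gamma> * real k)) \<le> c * B" by blast
  show ?thesis
  proof (rule that[of c])
    fix m and Q :: "nat \<Rightarrow> real" assume Q: "\<And>k. Q k \<ge> 0"
    \<comment> \<open>Each factor \<open>sqrt (Q k)\<close> is split as half a power of the weight times its inverse.\<close>
    have half: "(R powr (x / 2))\<^sup>2 = R powr x" for x
      using assms(1) by (simp add: power2_eq_square flip: powr_add)
    have "(\<Sum>k<m. sqrt (Q k))\<^sup>2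
        = (\<Sum>k<m. R powr (\<gamma> * real (Suc k) / 2) * (R powr (- \<gamma> * real (Suc k) / 2) * sqrt (Q k)))\<^sup>2"
      using assms(1) by (intro arg_cong[of _ _ "\<lambda>x. x\<^sup>2"] sum.cong) (auto simp flip: powr_add mult.assoc)
    also have "\<dots> \<le> (\<Sum>k<m. (R powr (\<gamma> * real (Suc k) / 2))\<^sup>2)
        * (\<Sum>k<m. (R powr (- \<gamma> * real (Suc k) / 2) * sqrt (Q k))\<^sup>2)"
      by (rule Cauchy_Schwarz_ineq_sum)
    also have "\<dots> = (\<Sum>k<m. R powr (\<gamma> * real (Suc k))) * (\<Sum>k<m. R powr (- \<gamma> * real (Suc k)) * Q k)"
      unfolding power_mult_distrib half using Q by simp
    also have "\<dots> \<le> (c * R powr (\<gamma> * real m)) * (\<Sum>k<m. R powr (- \<gamma> * real (Suc k)) * Q k)"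
    proof (rule mult_right_mono)
      have "(\<Sum>k<m. R powr (\<gamma> * real (Suc k))) = (\<Sum>k\<in>Suc ` {..<m}. R powr (\<gamma> * real k))"
        by (subst sum.reindex) auto
      also have "\<dots> \<le> c * R powr (\<gamma> * real m)"
        using assms by (intro c(2)) auto
      finally show "(\<Sum>k<m. R powr (\<gamma> * real (Suc k))) \<le> c * R powr (\<gamma> * real m)" .
    qed (use Q in \<open>auto intro!: sum_nonneg\<close>)
    finally show "(\<Sum>k<m. sqrt (Q k))\<^sup>2 \<le> c * (R powr (\<gamma> * real m) * (\<Sum>k<m. R powr (- \<gamma> * real (Suc k)) * Q k))"
      by (simp add: mult_ac)
  qed (use c in simp)
qed

section \<open>Moments under domination of tails\<close>

text \<open>
  The layer-cake formula, by Tonelli for the region between 0 and \<open>Z\<close>.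
\<close>
lemma (in sigma_finite_measure) nn_integral_eq_tail_integral:
  fixes Z :: "'a \<Rightarrow> real"
  assumes [measurable]: "Z \<in> borel_measurable M" and nn: "\<And>\<omega>. Z \<omega> \<ge> 0"
  shows "(\<integral>\<^sup>+\<omega>. ennreal (Z \<omega>) \<partial>M)
       = (\<integral>\<^sup>+t. indicator {0<..} t * emeasure M {\<omega> \<in> space M. Z \<omega> > t} \<partial>lborel)"
proof -
  interpret P: pair_sigma_finite M lborel ..
  let ?f = "\<lambda>\<omega> t. indicator {x. 0 < snd x \<and> snd x < Z (fst x)} (\<omega>, t) :: ennreal"
  have "ennreal (Z \<omega>) = (\<integral>\<^sup>+t. ?f \<omega> t \<partial>lborel)" if "\<omega> \<in> space M" for \<omega>
  proof -
    have "(\<integral>\<^sup>+t. ?f \<omega> t \<partial>lborel) = (\<integral>\<^sup>+t. indicator {0<..<Z \<omega>} t \<partial>lborel)"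
      by (intro nn_integral_cong) (auto simp: indicator_def)
    then show ?thesis using nn by simp
  qed
  then have "(\<integral>\<^sup>+\<omega>. ennreal (Z \<omega>) \<partial>M) = (\<integral>\<^sup>+\<omega>. \<integral>\<^sup>+t. ?f \<omega> t \<partial>lborel \<partial>M)"
    by (rule nn_integral_cong)
  also have "\<dots> = (\<integral>\<^sup>+t. \<integral>\<^sup>+\<omega>. ?f \<omega> t \<partial>M \<partial>lborel)"
    by (rule P.Fubini'[symmetric]) measurable
  also have "\<dots> = (\<integral>\<^sup>+t. indicator {0<..} t * emeasure M {\<omega> \<in> space M. Z \<omega> > t} \<partial>lborel)"
  proof (rule nn_integral_cong)
    fix t
    have "(\<integral>\<^sup>+\<omega>. ?f \<omega> t \<partial>M) = (\<integral>\<^sup>+\<omega>. indicator {0<..} t * indicator {\<omega> \<in> space M. Z \<omega> > t} \<omega> \<partial>M)"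
      by (intro nn_integral_cong) (auto simp: indicator_def)
    also have "\<dots> = indicator {0<..} t * emeasure M {\<omega> \<in> space M. Z \<omega> > t}"
      by (subst nn_integral_cmult_indicator) auto
    finally show "(\<integral>\<^sup>+\<omega>. ?f \<omega> t \<partial>M) = indicator {0<..} t * emeasure M {\<omega> \<in> space M. Z \<omega> > t}" .
  qed
  finally show ?thesis .
qed

text \<open>
  Domination of tails passes to \<open>\<phi> \<bar>U\<bar>\<close> whenever the superlevel sets of \<open>\<phi>\<close> on the half-line are
  again open half-lines or empty; the layer-cake formula then compares the integrals. The two instances
  needed below are \<open>(min x L)\<^sup>2\<close> and \<open>max 0 (x - L)\<close>.
\<close>
lemma (in prob_space) nn_integral_le_of_tail_le:
  fixes U V :: "'a \<Rightarrow> real" and \<phi> :: "real \<Rightarrow> real"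
  assumes [measurable]: "U \<in> borel_measurable M" "V \<in> borel_measurable M" "\<phi> \<in> borel_measurable borel"
    and C: "C \<ge> 0"
    and tail: "\<And>t. t > 0 \<Longrightarrow> prob {\<omega> \<in> space M. \<bar>U \<omega>\<bar> > t} \<le> C * prob {\<omega> \<in> space M. \<bar>V \<omega>\<bar> > t}"
    and nn: "\<And>x. \<phi> x \<ge> 0"
    and level: "\<And>t. t > 0 \<Longrightarrow> (\<exists>s>0. \<forall>x\<ge>0. t < \<phi> x \<longleftrightarrow> s < x) \<or> (\<forall>x\<ge>0. \<phi> x \<le> t)"
  shows "(\<integral>\<^sup>+\<omega>. ennreal (\<phi> \<bar>U \<omega>\<bar>) \<partial>M) \<le> ennreal C * (\<integral>\<^sup>+\<omega>. ennreal (\<phi> \<bar>V \<omega>\<bar>) \<partial>M)"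
proof -
  have le: "emeasure M {\<omega> \<in> space M. t < \<phi> \<bar>U \<omega>\<bar>} \<le> ennreal C * emeasure M {\<omega> \<in> space M. t < \<phi> \<bar>V \<omega>\<bar>}"
    if "t > 0" for t
    using level[OF that]
  proof
    assume "\<exists>s>0. \<forall>x\<ge>0. t < \<phi> x \<longleftrightarrow> s < x"
    then obtain s where s: "s > 0" "\<And>x. x \<ge> 0 \<Longrightarrow> t < \<phi> x \<longleftrightarrow> s < x" by blast
    show ?thesis
      using tail[OF s(1)] C by (simp add: s(2) emeasure_eq_measure flip: ennreal_mult)
  next
    assume *: "\<forall>x\<ge>0. \<phi> x \<le> t"
    then have "{\<omega> \<in> space M. t < \<phi> \<bar>U \<omega>\<bar>} = {}" by (auto simp: not_less)
    then show ?thesis by (simp only:) simp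
  qed
  have [measurable]: "(\<lambda>t. indicator {0<..} t * emeasure M {\<omega> \<in> space M. t < \<phi> \<bar>V \<omega>\<bar>}) \<in> borel_measurable lborel"
    by measurable
  have "(\<integral>\<^sup>+\<omega>. ennreal (\<phi> \<bar>U \<omega>\<bar>) \<partial>M)
      \<le> (\<integral>\<^sup>+t. ennreal C * (indicator {0<..} t * emeasure M {\<omega> \<in> space M. t < \<phi> \<bar>V \<omega>\<bar>}) \<partial>lborel)"
    by (subst nn_integral_eq_tail_integral)
       (auto simp: nn indicator_def intro!: nn_integral_mono le)
  also have "\<dots> = ennreal C * (\<integral>\<^sup>+\<omega>. ennreal (\<phi> \<bar>V \<omega>\<bar>) \<partial>M)"
    by (subst nn_integral_cmult) (auto simp: nn_integral_eq_tail_integral nn)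
  finally show ?thesis .
qed

lemma (in prob_space) truncated_second_moment_le:
  fixes U V :: "'a \<Rightarrow> real"
  assumes [measurable]: "U \<in> borel_measurable M" "V \<in> borel_measurable M"
    and C: "C \<ge> 0" and L: "L > 0"
    and tail: "\<And>t. t > 0 \<Longrightarrow> prob {\<omega> \<in> space M. \<bar>U \<omega>\<bar> > t} \<le> C * prob {\<omega> \<in> space M. \<bar>V \<omega>\<bar> > t}"
  shows "expectation (\<lambda>\<omega>. (min \<bar>U \<omega>\<bar> L)\<^sup>2) \<le> C * expectation (\<lambda>\<omega>. (min \<bar>V \<omega>\<bar> L)\<^sup>2)"
proof -
  have int: "integrable M (\<lambda>\<omega>. (min \<bar>W \<omega>\<bar> L)\<^sup>2)" if [measurable]: "W \<in> borel_measurable M" for W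
    by (rule integrable_const_bound[where B = "L\<^sup>2"]) (use L in \<open>auto intro!: power_mono\<close>)
  have "(\<integral>\<^sup>+\<omega>. ennreal ((min \<bar>U \<omega>\<bar> L)\<^sup>2) \<partial>M) \<le> ennreal C * (\<integral>\<^sup>+\<omega>. ennreal ((min \<bar>V \<omega>\<bar> L)\<^sup>2) \<partial>M)"
  proof (rule nn_integral_le_of_tail_le[where \<phi> = "\<lambda>x. (min x L)\<^sup>2"])
    fix t :: real assume t: "t > 0"
    show "(\<exists>s>0. \<forall>x\<ge>0. t < (min x L)\<^sup>2 \<longleftrightarrow> s < x) \<or> (\<forall>x\<ge>0. (min x L)\<^sup>2 \<le> t)"
    proof (cases "t < L\<^sup>2")
      case True
      have "sqrt t < L" using True L real_sqrt_less_iff[of t "L\<^sup>2"] by simp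
      have "t < (min x L)\<^sup>2 \<longleftrightarrow> sqrt t < x" if "x \<ge> 0" for x
      proof -
        have "t < (min x L)\<^sup>2 \<longleftrightarrow> sqrt t < min x L"
          using that L real_sqrt_less_iff[of t "(min x L)\<^sup>2"] by simp
        with \<open>sqrt t < L\<close> show ?thesis by auto
      qed
      with t show ?thesis by (intro disjI1 exI[of _ "sqrt t"]) auto
    next
      case False
      have "(min x L)\<^sup>2 \<le> L\<^sup>2" if "x \<ge> 0" for x using that L by (intro power_mono) auto
      with False show ?thesis by force
    qed
  qed (use C tail in auto)
  then have "ennreal (expectation (\<lambda>\<omega>. (min \<bar>U \<omega>\<bar> L)\<^sup>2)) \<le> ennreal (C * expectation (\<lambda>\<omega>. (min \<bar>V \<omega>\<bar> L)\<^sup>2))"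
    using C by (simp add: nn_integral_eq_integral int ennreal_mult)
  then show ?thesis using C by (subst (asm) ennreal_le_iff) auto
qed

lemma (in prob_space) tail_excess_le:
  fixes U V :: "'a \<Rightarrow> real"
  assumes [measurable]: "U \<in> borel_measurable M" "V \<in> borel_measurable M"
    and C: "C \<ge> 0" and L: "L \<ge> 0"
    and tail: "\<And>t. t > 0 \<Longrightarrow> prob {\<omega> \<in> space M. \<bar>U \<omega>\<bar> > t} \<le> C * prob {\<omega> \<in> space M. \<bar>V \<omega>\<bar> > t}"
    and V: "integrable M (\<lambda>\<omega>. \<bar>V \<omega>\<bar>)"
  shows "integrable M (\<lambda>\<omega>. max 0 (\<bar>U \<omega>\<bar> - L))"
    and "expectation (\<lambda>\<omega>. max 0 (\<bar>U \<omega>\<bar> - L)) \<le> C * expectation (\<lambda>\<omega>. max 0 (\<bar>V \<omega>\<bar> - L))"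
proof -
  have intV: "integrable M (\<lambda>\<omega>. max 0 (\<bar>V \<omega>\<bar> - L))"
    by (rule Bochner_Integration.integrable_bound[OF V]) (use L in auto)
  have le: "(\<integral>\<^sup>+\<omega>. ennreal (max 0 (\<bar>U \<omega>\<bar> - L)) \<partial>M) \<le> ennreal C * (\<integral>\<^sup>+\<omega>. ennreal (max 0 (\<bar>V \<omega>\<bar> - L)) \<partial>M)"
  proof (rule nn_integral_le_of_tail_le[where \<phi> = "\<lambda>x. max 0 (x - L)"])
    fix t :: real assume t: "t > 0"
    show "(\<exists>s>0. \<forall>x\<ge>0. t < max 0 (x - L) \<longleftrightarrow> s < x) \<or> (\<forall>x\<ge>0. max 0 (x - L) \<le> t)"
      using t L by (intro disjI1 exI[of _ "L + t"]) auto
  qed (use C tail in auto)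
  also have "\<dots> = ennreal (C * expectation (\<lambda>\<omega>. max 0 (\<bar>V \<omega>\<bar> - L)))"
    using C by (subst nn_integral_eq_integral[OF intV]) (auto simp: ennreal_mult)
  finally have le: "(\<integral>\<^sup>+\<omega>. ennreal (max 0 (\<bar>U \<omega>\<bar> - L)) \<partial>M) \<le> ennreal (C * expectation (\<lambda>\<omega>. max 0 (\<bar>V \<omega>\<bar> - L)))" .
  then have "(\<integral>\<^sup>+\<omega>. ennreal (max 0 (\<bar>U \<omega>\<bar> - L)) \<partial>M) < \<infinity>"
    by (rule order.strict_trans1) simp
  then show int: "integrable M (\<lambda>\<omega>. max 0 (\<bar>U \<omega>\<bar> - L))"
    by (intro integrableI_nonneg) auto
  from le have "ennreal (expectation (\<lambda>\<omega>. max 0 (\<bar>U \<omega>\<bar> - L))) \<le> ennreal (C * expectation (\<lambda>\<omega>. max 0 (\<bar>V \<omega>\<bar> - L)))"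
    by (subst (asm) nn_integral_eq_integral[OF int]) auto
  then show "expectation (\<lambda>\<omega>. max 0 (\<bar>U \<omega>\<bar> - L)) \<le> C * expectation (\<lambda>\<omega>. max 0 (\<bar>V \<omega>\<bar> - L))"
    using C by (subst (asm) ennreal_le_iff) auto
qed

text \<open>
  If \<open>\<bar>Y\<bar>\<close> exceeds the level \<open>L = R powr (k/p)\<close>, then the factor in front is
  \<open>L powr (p - 1) \<le> \<bar>Y\<bar> powr (p - 1)\<close>, so \<open>\<bar>Y\<bar> powr p\<close> is an integrable majorant. Pointwise the
  excess vanishes from some \<open>k\<close> on.
\<close>
lemma (in prob_space) scaled_tail_excess_tendsto_zero:
  fixes Y :: "'a \<Rightarrow> real" and R p :: real
  assumes [measurable]: "Y \<in> borel_measurable M"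
    and Y: "integrable M (\<lambda>\<omega>. \<bar>Y \<omega>\<bar> powr p)" and R: "R > 1" and p: "p \<ge> 1"
  shows "(\<lambda>k. R powr (real k * (1 - 1 / p)) * expectation (\<lambda>\<omega>. max 0 (\<bar>Y \<omega>\<bar> - R powr (real k / p)))) \<longlonglongrightarrow> 0"
proof -
  let ?L = "\<lambda>k::nat. R powr (real k / p)"
  let ?f = "\<lambda>k \<omega>. R powr (real k * (1 - 1 / p)) * max 0 (\<bar>Y \<omega>\<bar> - ?L k)"
  have L_top: "filterlim ?L at_top sequentially"
  proof -
    have "?L k = (R powr (1 / p)) ^ k" for k
      using R by (simp add: powr_powr flip: powr_realpow)
    moreover have "R powr (1 / p) > 1" using R p by simp
    moreover have "\<And>k. (R powr (1 / p)) ^ k > 0" using R by (intro zero_less_power) simp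
    ultimately show ?thesis by (auto intro!: filterlim_at_infinity_imp_filterlim_at_top filterlim_realpow_sequentially_gt1 always_eventually)
  qed
  have "(\<lambda>k. expectation (?f k)) \<longlonglongrightarrow> expectation (\<lambda>_. 0)"
  proof (rule integral_dominated_convergence[OF _ _ Y])
    show "AE \<omega> in M. (\<lambda>k. ?f k \<omega>) \<longlonglongrightarrow> 0"
    proof (rule AE_I2)
      fix \<omega>
      have "\<forall>\<^sub>F k in sequentially. \<bar>Y \<omega>\<bar> \<le> ?L k"
        using L_top unfolding filterlim_at_top by blast
      then have "\<forall>\<^sub>F k in sequentially. 0 = ?f k \<omega>"
        by eventually_elim simp
      then show "(\<lambda>k. ?f k \<omega>) \<longlonglongrightarrow> 0"
        by (rule Lim_transform_eventually[OF tendsto_const])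
    qed
    show "AE \<omega> in M. norm (?f k \<omega>) \<le> \<bar>Y \<omega>\<bar> powr p" for k
    proof (rule AE_I2)
      fix \<omega>
      show "norm (?f k \<omega>) \<le> \<bar>Y \<omega>\<bar> powr p"
      proof (cases "\<bar>Y \<omega>\<bar> \<le> ?L k")
        case False
        have pos: "?L k > 0" using R by simp
        have "R powr (real k * (1 - 1 / p)) = (?L k) powr (p - 1)"
          using p by (simp add: powr_powr field_simps)
        also have "\<dots> \<le> \<bar>Y \<omega>\<bar> powr (p - 1)"
          using False pos p by (intro powr_mono2) auto
        finally have "norm (?f k \<omega>) \<le> \<bar>Y \<omega>\<bar> powr (p - 1) * \<bar>Y \<omega>\<bar>"
          using False pos by (simp add: abs_mult) (intro mult_mono, auto)
        also have "\<dots> = \<bar>Y \<omega>\<bar> powr p"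
          using False pos powr_mult_base[of "\<bar>Y \<omega>\<bar>" "p - 1"] by (simp add: mult.commute)
        finally show ?thesis .
      qed simp
    qed
  qed auto
  then show ?thesis by simp
qed

section \<open>Second moments of block sums\<close>

definition index_pairs :: "nat set \<Rightarrow> (nat \<times> nat) set" where
  "index_pairs I = {(i, j). i \<in> I \<and> j \<in> I \<and> i < j}"

lemma finite_index_pairs: "finite I \<Longrightarrow> finite (index_pairs I)"
  by (rule finite_subset[of _ "I \<times> I"]) (auto simp: index_pairs_def)

lemma index_pairs_mono: "I \<subseteq> J \<Longrightarrow> index_pairs I \<subseteq> index_pairs J"
  by (auto simp: index_pairs_def)

text \<open>
  Negative covariances are dropped and variances are enlarged to second moments; in this form the bound
  is monotone in the index set.
\<close>
lemma (in prob_space) second_moment_of_sum_le: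
  fixes U :: "nat \<Rightarrow> 'a \<Rightarrow> real"
  assumes I: "finite I"
    and meas: "\<And>i. i \<in> I \<Longrightarrow> U i \<in> borel_measurable M"
    and bd: "\<And>i \<omega>. i \<in> I \<Longrightarrow> \<bar>U i \<omega>\<bar> \<le> B"
  shows "integrable M (\<lambda>\<omega>. (\<Sum>i\<in>I. U i \<omega> - expectation (U i))\<^sup>2)"
    and "expectation (\<lambda>\<omega>. (\<Sum>i\<in>I. U i \<omega> - expectation (U i))\<^sup>2)
      \<le> (\<Sum>i\<in>I. expectation (\<lambda>\<omega>. (U i \<omega>)\<^sup>2))
        + 2 * (\<Sum>(i, j)\<in>index_pairs I. max 0 (covariance M (U i) (U j)))"
proof -
  define Z where "Z i \<omega> = U i \<omega> - expectation (U i)" for i \<omega>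
  have intU: "integrable M (U i)" if "i \<in> I" for i
    using meas[OF that] bd[OF that] by (intro integrable_const_bound[where B = B]) auto
  have Zm: "Z i \<in> borel_measurable M" if "i \<in> I" for i
    using meas[OF that] unfolding Z_def by measurable
  have Zb: "\<bar>Z i \<omega>\<bar> \<le> 2 * B" if "i \<in> I" for i \<omega>
  proof -
    have "\<bar>expectation (U i)\<bar> \<le> expectation (\<lambda>\<omega>. \<bar>U i \<omega>\<bar>)" by (rule integral_abs_bound)
    also have "\<dots> \<le> B" using intU[OF that] bd[OF that] by (intro integral_le_const) auto
    finally show ?thesis using bd[OF that, of \<omega>] unfolding Z_def by linarith
  qed
  have int: "integrable M (\<lambda>\<omega>. Z i \<omega> * Z j \<omega>)" if "i \<in> I" "j \<in> I" for i j
  proof (rule integrable_const_bound[where B = "2 * B * (2 * B)"])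
    show "AE \<omega> in M. norm (Z i \<omega> * Z j \<omega>) \<le> 2 * B * (2 * B)"
    proof (rule AE_I2)
      fix \<omega>
      have "0 \<le> 2 * B" using Zb[OF that(1), of \<omega>] by linarith
      then show "norm (Z i \<omega> * Z j \<omega>) \<le> 2 * B * (2 * B)"
        unfolding real_norm_def abs_mult by (intro mult_mono Zb that) auto
    qed
  qed (use that Zm in measurable)
  have sq: "(\<Sum>i\<in>I. Z i \<omega>)\<^sup>2 = (\<Sum>(i, j)\<in>I \<times> I. Z i \<omega> * Z j \<omega>)" for \<omega>
    by (simp add: power2_eq_square sum_product sum.cartesian_product)
  show "integrable M (\<lambda>\<omega>. (\<Sum>i\<in>I. U i \<omega> - expectation (U i))\<^sup>2)"
    unfolding Z_def[symmetric] sq using int by (intro Bochner_Integration.integrable_sum) auto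
  let ?c = "\<lambda>i j. expectation (\<lambda>\<omega>. Z i \<omega> * Z j \<omega>)"
  define P where "P = index_pairs I"
  have P: "finite P" using I by (simp add: P_def finite_index_pairs)
  have split: "I \<times> I = (\<lambda>i. (i, i)) ` I \<union> (P \<union> prod.swap ` P)"
    by (auto simp: P_def index_pairs_def image_iff)
  have "expectation (\<lambda>\<omega>. (\<Sum>i\<in>I. Z i \<omega>)\<^sup>2) = (\<Sum>(i, j)\<in>I \<times> I. ?c i j)"
    unfolding sq using int by (subst Bochner_Integration.integral_sum) (auto simp: case_prod_beta)
  also have "\<dots> = (\<Sum>(i, j)\<in>(\<lambda>i. (i, i)) ` I. ?c i j) + ((\<Sum>(i, j)\<in>P. ?c i j) + (\<Sum>(i, j)\<in>prod.swap ` P. ?c i j))"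
    unfolding split using I P by (subst sum.union_disjoint; (subst sum.union_disjoint)?) (auto simp: P_def index_pairs_def)
  also have "(\<Sum>(i, j)\<in>(\<lambda>i. (i, i)) ` I. ?c i j) = (\<Sum>i\<in>I. ?c i i)"
    by (subst sum.reindex) (auto simp: inj_on_def)
  also have "(\<Sum>(i, j)\<in>prod.swap ` P. ?c i j) = (\<Sum>(i, j)\<in>P. ?c i j)"
    by (subst sum.reindex) (auto simp: case_prod_beta mult.commute intro!: sum.cong)
  finally have eq: "expectation (\<lambda>\<omega>. (\<Sum>i\<in>I. Z i \<omega>)\<^sup>2) = (\<Sum>i\<in>I. ?c i i) + 2 * (\<Sum>(i, j)\<in>P. ?c i j)"
    by simp
  have "?c i i \<le> expectation (\<lambda>\<omega>. (U i \<omega>)\<^sup>2)" if "i \<in> I" for i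
  proof -
    have "integrable M (\<lambda>\<omega>. (U i \<omega>)\<^sup>2)"
      using meas[OF that] bd[OF that]
      by (intro integrable_const_bound[where B = "B\<^sup>2"]) (auto simp: power2_le_iff_abs_le intro!: AE_I2 abs_le_square_iff[THEN iffD1] order_trans[OF _ abs_ge_self])
    with intU[OF that] have "variance (U i) = expectation (\<lambda>\<omega>. (U i \<omega>)\<^sup>2) - (expectation (U i))\<^sup>2"
      by (rule variance_eq)
    then show ?thesis by (simp add: Z_def power2_eq_square)
  qed
  then have "(\<Sum>i\<in>I. ?c i i) \<le> (\<Sum>i\<in>I. expectation (\<lambda>\<omega>. (U i \<omega>)\<^sup>2))" by (rule sum_mono)
  moreover have "(\<Sum>(i, j)\<in>P. ?c i j) \<le> (\<Sum>(i, j)\<in>P. max 0 (covariance M (U i) (U j)))"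
    by (intro sum_mono) (auto simp: covariance_def Z_def)
  ultimately show "expectation (\<lambda>\<omega>. (\<Sum>i\<in>I. U i \<omega> - expectation (U i))\<^sup>2)
      \<le> (\<Sum>i\<in>I. expectation (\<lambda>\<omega>. (U i \<omega>)\<^sup>2))
        + 2 * (\<Sum>(i, j)\<in>index_pairs I. max 0 (covariance M (U i) (U j)))"
    unfolding Z_def[symmetric] eq P_def[symmetric] by linarith
qed

text \<open>
  A pair of indices lies in at most one of the blocks, so at each scale the covariances are counted
  only once.
\<close>
lemma sum_over_disjoint_blocks_le:
  fixes v :: "nat \<Rightarrow> real" and w :: "nat \<Rightarrow> nat \<Rightarrow> real"
  assumes "finite A" "finite J" "\<And>b. b \<in> A \<Longrightarrow> I b \<subseteq> J" "disjoint_family_on I A"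
    and v: "\<And>i. v i \<ge> 0" and w: "\<And>i j. w i j \<ge> 0"
  shows "(\<Sum>b\<in>A. (\<Sum>i\<in>I b. v i) + 2 * (\<Sum>(i, j)\<in>index_pairs (I b). w i j))
     \<le> (\<Sum>i\<in>J. v i) + 2 * (\<Sum>(i, j)\<in>index_pairs J. w i j)"
proof -
  have fin: "finite (I b)" if "b \<in> A" for b using assms that by (meson finite_subset)
  have "(\<Sum>b\<in>A. \<Sum>i\<in>I b. v i) = (\<Sum>i\<in>(\<Union>b\<in>A. I b). v i)"
    using assms fin by (subst sum.UNION_disjoint) (auto simp: disjoint_family_on_def)
  also have "\<dots> \<le> (\<Sum>i\<in>J. v i)" using assms by (intro sum_mono2) auto
  finally have 1: "(\<Sum>b\<in>A. \<Sum>i\<in>I b. v i) \<le> (\<Sum>i\<in>J. v i)" .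
  have "(\<Sum>b\<in>A. \<Sum>(i, j)\<in>index_pairs (I b). w i j) = (\<Sum>(i, j)\<in>(\<Union>b\<in>A. index_pairs (I b)). w i j)"
  proof (rule sum.UNION_disjoint[symmetric])
    show "\<forall>b\<in>A. \<forall>b'\<in>A. b \<noteq> b' \<longrightarrow> index_pairs (I b) \<inter> index_pairs (I b') = {}"
      using assms(4) unfolding disjoint_family_on_def index_pairs_def by blast
  qed (use assms(1) fin in \<open>auto intro: finite_index_pairs\<close>)
  also have "\<dots> \<le> (\<Sum>(i, j)\<in>index_pairs J. w i j)"
    using assms(2) w index_pairs_mono[OF assms(3)]
    by (intro sum_mono2) (force intro: finite_index_pairs)+
  finally have 2: "(\<Sum>b\<in>A. \<Sum>(i, j)\<in>index_pairs (I b). w i j) \<le> (\<Sum>(i, j)\<in>index_pairs J. w i j)" .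
  have "(\<Sum>b\<in>A. (\<Sum>i\<in>I b. v i) + 2 * (\<Sum>(i, j)\<in>index_pairs (I b). w i j))
      = (\<Sum>b\<in>A. \<Sum>i\<in>I b. v i) + 2 * (\<Sum>b\<in>A. \<Sum>(i, j)\<in>index_pairs (I b). w i j)"
    by (simp add: sum.distrib sum_distrib_left)
  with 1 2 show ?thesis by linarith
qed

text \<open>
  Each of the \<open>r\<close> initial segments of a block is bounded by the full block, which costs the factor
  \<open>r\<close>; passing from a segment to the block is possible only because the covariances have been
  replaced by their positive parts. The disjoint blocks are then merged into all indices up to \<open>r ^ m\<close>.
\<close>
lemma (in prob_space) expected_block_energy_le:
  fixes U V :: "nat \<Rightarrow> 'a \<Rightarrow> real"
  assumes r: "r > 1" and k: "k < m"
    and meas: "\<And>i. i \<ge> 1 \<Longrightarrow> U i \<in> borel_measurable M" "\<And>i. i \<ge> 1 \<Longrightarrow> V i \<in> borel_measurable M"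
    and bd: "\<And>i \<omega>. \<bar>U i \<omega>\<bar> \<le> B" "\<And>i \<omega>. \<bar>V i \<omega>\<bar> \<le> B"
  defines "E \<equiv> \<lambda>\<omega>. block_energy r k m (\<lambda>i. U i \<omega> - expectation (U i)) (\<lambda>i. V i \<omega> - expectation (V i))"
  shows "integrable M E"
    and "expectation E \<le> real r *
      ((\<Sum>i\<in>{0<..r ^ m}. expectation (\<lambda>\<omega>. (U i \<omega>)\<^sup>2) + expectation (\<lambda>\<omega>. (V i \<omega>)\<^sup>2))
       + 2 * (\<Sum>(i, j)\<in>index_pairs {0<..r ^ m}.
                max 0 (covariance M (U i) (U j)) + max 0 (covariance M (V i) (V j))))"
proof -
  define I where "I b = {b * r ^ Suc k<..Suc b * r ^ Suc k}" for b
  define J where "J b s = {b * r ^ Suc k<..b * r ^ Suc k + s * r ^ k}" for b s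
  define S where "S W K \<omega> = (\<Sum>i\<in>K. W i \<omega> - expectation (W i))\<^sup>2" for W :: "nat \<Rightarrow> 'a \<Rightarrow> real" and K \<omega>
  define \<Phi> where "\<Phi> W K = (\<Sum>i\<in>K. expectation (\<lambda>\<omega>. (W i \<omega>)\<^sup>2))
     + 2 * (\<Sum>(i, j)\<in>index_pairs K. max 0 (covariance M (W i) (W j)))" for W :: "nat \<Rightarrow> 'a \<Rightarrow> real" and K
  have IJ: "finite (I b)" "finite (J b s)" "\<And>i. i \<in> I b \<Longrightarrow> i \<ge> 1" "\<And>i. i \<in> J b s \<Longrightarrow> i \<ge> 1" for b s
    by (auto simp: I_def J_def)
  have J_sub: "J b s \<subseteq> I b" if "s < r" for b s
  proof -
    have "s * r ^ k \<le> r * r ^ k" using that by (intro mult_right_mono) auto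
    then have "b * r ^ Suc k + s * r ^ k \<le> Suc b * r ^ Suc k" by simp
    then show ?thesis unfolding I_def J_def by (auto simp del: power_Suc mult_Suc intro: order_trans)
  qed
  have E: "E \<omega> = (\<Sum>b<r ^ (m - Suc k). (\<Sum>s<r. S U (J b s) \<omega>) + S V (I b) \<omega>)" for \<omega>
    by (simp add: E_def block_energy_def S_def I_def J_def)
  have SU: "integrable M (S U (J b s))" "expectation (S U (J b s)) \<le> \<Phi> U (J b s)" for b s
    using second_moment_of_sum_le[of "J b s" U B] IJ meas bd
    unfolding S_def \<Phi>_def by blast+
  have SV: "integrable M (S V (I b))" "expectation (S V (I b)) \<le> \<Phi> V (I b)" for b
    using second_moment_of_sum_le[of "I b" V B] IJ meas bd
    unfolding S_def \<Phi>_def by blast+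
  show "integrable M E"
    unfolding E using SU SV by (intro Bochner_Integration.integrable_sum Bochner_Integration.integrable_add)
  have \<Phi>_mono: "\<Phi> W K \<le> \<Phi> W K'" if "K \<subseteq> K'" "finite K'" for W K K'
    unfolding \<Phi>_def using that index_pairs_mono[OF that(1)]
    by (intro add_mono mult_left_mono sum_mono2 finite_index_pairs) auto
  have \<Phi>_nonneg: "\<Phi> W K \<ge> 0" for W K
    unfolding \<Phi>_def by (intro add_nonneg_nonneg mult_nonneg_nonneg sum_nonneg) auto
  have "expectation E = (\<Sum>b<r ^ (m - Suc k). (\<Sum>s<r. expectation (S U (J b s))) + expectation (S V (I b)))"
    unfolding E using SU SV by (simp add: Bochner_Integration.integral_sum Bochner_Integration.integral_add)
  also have "\<dots> \<le> (\<Sum>b<r ^ (m - Suc k). real r * (\<Phi> U (I b) + \<Phi> V (I b)))"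
  proof (rule sum_mono)
    fix b
    have "(\<Sum>s<r. expectation (S U (J b s))) \<le> (\<Sum>s<r. \<Phi> U (I b))"
      using SU(2) \<Phi>_mono[OF J_sub IJ(1)] by (intro sum_mono) (meson lessThan_iff order_trans)
    moreover have "expectation (S V (I b)) \<le> real r * \<Phi> V (I b)"
      using SV(2)[of b] \<Phi>_nonneg[of V "I b"] r mult_right_mono[of 1 "real r" "\<Phi> V (I b)"] by simp
    ultimately show "(\<Sum>s<r. expectation (S U (J b s))) + expectation (S V (I b))
        \<le> real r * (\<Phi> U (I b) + \<Phi> V (I b))"
      by (simp add: algebra_simps)
  qed
  also have "\<dots> = real r * ((\<Sum>b<r ^ (m - Suc k). \<Phi> U (I b)) + (\<Sum>b<r ^ (m - Suc k). \<Phi> V (I b)))"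
    by (simp only: sum_distrib_left sum.distrib distrib_left)
  also have "\<dots> \<le> real r * (\<Phi> U {0<..r ^ m} + \<Phi> V {0<..r ^ m})"
  proof (intro mult_left_mono add_mono)
    have disj: "disjoint_family_on I {..<r ^ (m - Suc k)}"
    proof -
      have "b = (i - 1) div r ^ Suc k" if "i \<in> I b" for i b
      proof (rule sym, rule div_nat_eqI)
        show "r ^ Suc k * b \<le> i - 1" "i - 1 < r ^ Suc k * Suc b"
          using that by (auto simp: I_def mult_ac)
      qed
      then show ?thesis unfolding disjoint_family_on_def by blast
    qed
    have sub: "I b \<subseteq> {0<..r ^ m}" if "b \<in> {..<r ^ (m - Suc k)}" for b
    proof -
      have "Suc b * r ^ Suc k \<le> r ^ (m - Suc k) * r ^ Suc k"
        using that by (intro mult_right_mono) auto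
      also have "\<dots> = r ^ m" using k by (metis Suc_leI le_add_diff_inverse2 power_add)
      finally show ?thesis by (auto simp: I_def)
    qed
    have le: "(\<Sum>b<r ^ (m - Suc k). \<Phi> W (I b)) \<le> \<Phi> W {0<..r ^ m}" for W
      unfolding \<Phi>_def using disj sub by (intro sum_over_disjoint_blocks_le) auto
    show "(\<Sum>b<r ^ (m - Suc k). \<Phi> U (I b)) \<le> \<Phi> U {0<..r ^ m}" by (rule le)
    show "(\<Sum>b<r ^ (m - Suc k). \<Phi> V (I b)) \<le> \<Phi> V {0<..r ^ m}" by (rule le)
  qed auto
  finally show "expectation E \<le> real r *
      ((\<Sum>i\<in>{0<..r ^ m}. expectation (\<lambda>\<omega>. (U i \<omega>)\<^sup>2) + expectation (\<lambda>\<omega>. (V i \<omega>)\<^sup>2))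
       + 2 * (\<Sum>(i, j)\<in>index_pairs {0<..r ^ m}.
                max 0 (covariance M (U i) (U j)) + max 0 (covariance M (V i) (V j))))"
    by (simp add: \<Phi>_def sum.distrib case_prod_beta algebra_simps)
qed

section \<open>Summation over the scales\<close>

text \<open>
  With the sum over \<open>m\<close> taken first, \<open>1 - 2/\<alpha> < 0\<close> makes its terms decrease, so it is of the order of
  its first term \<open>m = k + 1\<close>. There the exponents \<open>1 - 2/\<alpha>\<close> and \<open>- (2/p - 2/\<alpha>)\<close> add up to
  \<open>1 - 2/p\<close>.
\<close>
lemma sum_diagonal_le:
  fixes R p \<alpha> :: real
  assumes R: "R > 1" and \<alpha>: "0 < \<alpha>" "\<alpha> < 2"
  obtains c where "c > 0" "\<And>N \<mu>. (\<And>k. \<mu> k \<ge> 0) \<Longrightarrow>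
     (\<Sum>m<N. R powr ((1 - 2 / \<alpha>) * real m) * (\<Sum>k<m. R powr (- (2 / p - 2 / \<alpha>) * real (Suc k)) * \<mu> (Suc k)))
       \<le> c * (\<Sum>k<Suc N. R powr ((1 - 2 / p) * real k) * \<mu> k)"
proof -
  have "1 - 2 / \<alpha> \<noteq> 0" using \<alpha> by (simp add: field_simps)
  from geometric_sum_le_largest_term[OF R this] obtain c where c: "c > 0"
    "\<And>A B. \<lbrakk>finite A; 0 \<le> B; \<And>k. k \<in> A \<Longrightarrow> R powr ((1 - 2 / \<alpha>) * real k) \<le> B\<rbrakk>
       \<Longrightarrow> (\<Sum>k\<in>A. R powr ((1 - 2 / \<alpha>) * real k)) \<le> c * B" by blast
  show ?thesis
  proof (rule that[of c])
    fix N and \<mu> :: "nat \<Rightarrow> real" assume \<mu>: "\<And>k. \<mu> k \<ge> 0"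
    let ?u = "\<lambda>m::nat. R powr ((1 - 2 / \<alpha>) * real m)"
    let ?a = "\<lambda>k::nat. R powr (- (2 / p - 2 / \<alpha>) * real k)"
    have "(\<Sum>m<N. ?u m * (\<Sum>k<m. ?a (Suc k) * \<mu> (Suc k)))
        = (\<Sum>m<N. \<Sum>k\<in>{k \<in> {..<N}. k < m}. ?u m * (?a (Suc k) * \<mu> (Suc k)))"
      unfolding sum_distrib_left by (intro sum.cong) auto
    also have "\<dots> = (\<Sum>k<N. \<Sum>m\<in>{m \<in> {..<N}. k < m}. ?u m * (?a (Suc k) * \<mu> (Suc k)))"
      by (rule sum.swap_restrict) auto
    also have "\<dots> = (\<Sum>k<N. (\<Sum>m\<in>{m \<in> {..<N}. k < m}. ?u m) * (?a (Suc k) * \<mu> (Suc k)))"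
      by (simp add: sum_distrib_right)
    also have "\<dots> \<le> (\<Sum>k<N. c * ?u (Suc k) * (?a (Suc k) * \<mu> (Suc k)))"
    proof (intro sum_mono mult_right_mono c(2))
      fix k m assume "m \<in> {m \<in> {..<N}. k < m}"
      then have "real (Suc k) \<le> real m" by simp
      moreover have "1 - 2 / \<alpha> \<le> 0" using \<alpha> by (simp add: field_simps)
      ultimately show "?u m \<le> ?u (Suc k)"
        using R by (intro powr_mono mult_left_mono_neg) auto
    qed (use \<mu> in auto)
    also have "\<dots> = c * (\<Sum>k<N. R powr ((1 - 2 / p) * real (Suc k)) * \<mu> (Suc k))"
    proof -
      have "?u k * ?a k = R powr ((1 - 2 / p) * real k)" for k
        by (simp add: algebra_simps flip: powr_add)
      then have "c * ?u k * (?a k * \<mu> k) = c * (R powr ((1 - 2 / p) * real k) * \<mu> k)" for k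
        by (metis mult.assoc)
      then show ?thesis by (simp only: sum_distrib_left)
    qed
    also have "\<dots> \<le> c * (\<Sum>k<Suc N. R powr ((1 - 2 / p) * real k) * \<mu> k)"
      using c \<mu> by (intro mult_left_mono) (auto simp: sum.lessThan_Suc_shift simp del: sum.lessThan_Suc)
    finally show "(\<Sum>m<N. ?u m * (\<Sum>k<m. ?a (Suc k) * \<mu> (Suc k)))
        \<le> c * (\<Sum>k<Suc N. R powr ((1 - 2 / p) * real k) * \<mu> k)" .
  qed (use c in simp)
qed

text \<open>
  A pair \<open>i < j\<close> at scale \<open>k\<close> contributes for those \<open>m\<close> with \<open>m \<ge> k + 1\<close> and \<open>r ^ m \<ge> j\<close>,
  that is, for \<open>m\<close> at least \<open>max (k + 1) (log r j)\<close>; the decreasing geometric sum over these \<open>m\<close> is of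
  the order of its first term.
\<close>
lemma sum_off_diagonal_le:
  fixes \<alpha> :: real and r :: nat
  assumes r: "r > 1" and \<alpha>: "0 < \<alpha>"
  obtains c where "c > 0" "\<And>N a w. \<lbrakk>\<And>k. a k \<ge> 0; \<And>k i j. w k i j \<ge> 0\<rbrakk> \<Longrightarrow>
     (\<Sum>m<N. real r powr (- (2 / \<alpha>) * real m) * (\<Sum>k<m. a k * (\<Sum>(i, j)\<in>index_pairs {0<..r ^ m}. w k i j)))
       \<le> c * (\<Sum>(i, j)\<in>index_pairs {0<..r ^ N}. \<Sum>k<N.
               real r powr (- (2 / \<alpha>) * max (real (Suc k)) (log (real r) (real j))) * (a k * w k i j))"
proof -
  define R where "R = real r"
  have R: "R > 1" using r by (simp add: R_def)
  have "- (2 / \<alpha>) \<noteq> 0" using \<alpha> by simp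
  from geometric_sum_le_largest_term[OF R this] obtain c where c: "c > 0"
    "\<And>A B. \<lbrakk>finite A; 0 \<le> B; \<And>k. k \<in> A \<Longrightarrow> R powr (- (2 / \<alpha>) * real k) \<le> B\<rbrakk>
       \<Longrightarrow> (\<Sum>k\<in>A. R powr (- (2 / \<alpha>) * real k)) \<le> c * B" by blast
  show ?thesis
  proof (rule that[of c], unfold R_def[symmetric])
    fix N and a :: "nat \<Rightarrow> real" and w :: "nat \<Rightarrow> nat \<Rightarrow> nat \<Rightarrow> real"
    assume a: "\<And>k. a k \<ge> 0" and w: "\<And>k i j. w k i j \<ge> 0"
    let ?u = "\<lambda>x::real. R powr (- (2 / \<alpha>) * x)"
    let ?P = "index_pairs {0<..r ^ N}"
    let ?X = "?P \<times> {..<N}"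
    let ?ok = "\<lambda>m. \<lambda>((i::nat, j::nat), k). k < m \<and> j \<le> r ^ m"
    let ?g = "\<lambda>((i, j), k). a k * w k i j"
    have fin: "finite ?X" by (simp add: finite_index_pairs)
    have "(\<Sum>m<N. ?u m * (\<Sum>k<m. a k * (\<Sum>(i, j)\<in>index_pairs {0<..r ^ m}. w k i j)))
        = (\<Sum>m<N. \<Sum>x\<in>{x \<in> ?X. ?ok m x}. ?u m * ?g x)"
    proof (rule sum.cong[OF refl])
      fix m assume m: "m \<in> {..<N}"
      have rm: "r ^ m \<le> r ^ N" using m r by (intro power_increasing) auto
      have "{x \<in> ?X. ?ok m x} = index_pairs {0<..r ^ m} \<times> {..<m}"
        using m rm by (auto simp: index_pairs_def)
      then have "(\<Sum>x\<in>{x \<in> ?X. ?ok m x}. ?u m * ?g x)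
          = (\<Sum>(i, j)\<in>index_pairs {0<..r ^ m}. \<Sum>k<m. ?u m * (a k * w k i j))"
        by (simp add: sum.cartesian_product case_prod_beta)
      also have "\<dots> = (\<Sum>k<m. \<Sum>(i, j)\<in>index_pairs {0<..r ^ m}. ?u m * (a k * w k i j))"
        unfolding case_prod_unfold by (rule sum.swap)
      finally show "?u m * (\<Sum>k<m. a k * (\<Sum>(i, j)\<in>index_pairs {0<..r ^ m}. w k i j))
          = (\<Sum>x\<in>{x \<in> ?X. ?ok m x}. ?u m * ?g x)"
        by (simp add: sum_distrib_left case_prod_beta)
    qed
    also have "\<dots> = (\<Sum>x\<in>?X. \<Sum>m\<in>{m \<in> {..<N}. ?ok m x}. ?u m * ?g x)"
      by (rule sum.swap_restrict) (use fin in auto)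
    also have "\<dots> = (\<Sum>x\<in>?X. (\<Sum>m\<in>{m \<in> {..<N}. ?ok m x}. ?u m) * ?g x)"
      by (simp add: sum_distrib_right)
    also have "\<dots> \<le> (\<Sum>x\<in>?X. c * (case x of ((i, j), k) \<Rightarrow> ?u (max (real (Suc k)) (log R (real j)))) * ?g x)"
    proof (intro sum_mono mult_right_mono)
      fix x assume x: "x \<in> ?X"
      obtain i j k where x_eq: "x = ((i, j), k)" by (metis surj_pair)
      have j: "j > 0" using x by (auto simp: x_eq index_pairs_def)
      have "(\<Sum>m\<in>{m \<in> {..<N}. ?ok m x}. ?u m) \<le> c * ?u (max (real (Suc k)) (log R (real j)))"
      proof (rule c(2))
        fix m assume m: "m \<in> {m \<in> {..<N}. ?ok m x}"
        then have "real j \<le> R ^ m" by (simp add: x_eq R_def flip: of_nat_power)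
        then have "log R (real j) \<le> real m" using j R by (intro log_of_power_le) auto
        moreover have "real (Suc k) \<le> real m" using m by (simp add: x_eq)
        ultimately have "max (real (Suc k)) (log R (real j)) \<le> real m" by simp
        then show "?u m \<le> ?u (max (real (Suc k)) (log R (real j)))"
          using R \<alpha> by (intro powr_mono mult_left_mono_neg) auto
      qed auto
      then show "(\<Sum>m\<in>{m \<in> {..<N}. ?ok m x}. ?u m) \<le> c * (case x of ((i, j), k) \<Rightarrow> ?u (max (real (Suc k)) (log R (real j))))"
        by (simp add: x_eq)
    qed (use a w in \<open>auto simp: case_prod_beta\<close>)
    also have "\<dots> = c * (\<Sum>(i, j)\<in>?P. \<Sum>k<N. ?u (max (real (Suc k)) (log R (real j))) * (a k * w k i j))"
      by (simp add: sum.cartesian_product sum_distrib_left case_prod_beta mult.assoc)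
    finally show "(\<Sum>m<N. ?u m * (\<Sum>k<m. a k * (\<Sum>(i, j)\<in>index_pairs {0<..r ^ m}. w k i j)))
        \<le> c * (\<Sum>(i, j)\<in>?P. \<Sum>k<N. ?u (max (real (Suc k)) (log R (real j))) * (a k * w k i j))" .
  qed (use c in simp)
qed

lemma finite_sum_le_infsum_ennreal:
  fixes g :: "'b \<Rightarrow> ennreal"
  assumes "finite B" "B \<subseteq> A"
  shows "sum g B \<le> infsum g A"
  using assms by (subst nonneg_infsum_complete) (auto intro!: SUP_upper)

text \<open>
  A bound on finite real sums is what the interchanges of summation need; it avoids manipulating
  infinite sums of extended nonnegative reals.
\<close>
lemma finite_sums_le_of_infsum_finite:
  fixes f :: "nat \<Rightarrow> nat \<Rightarrow> nat \<Rightarrow> real"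
  assumes nn: "\<And>i j k. f i j k \<ge> 0"
    and fin: "(\<Sum>\<^sub>\<infinity>(i, j)\<in>P. \<Sum>\<^sub>\<infinity>k\<in>K. ennreal (f i j k)) < \<infinity>"
  obtains W where "\<And>F G. \<lbrakk>finite F; F \<subseteq> P; finite G; G \<subseteq> K\<rbrakk> \<Longrightarrow>
      (\<Sum>(i, j)\<in>F. \<Sum>k\<in>G. f i j k) \<le> W"
proof -
  let ?T = "\<Sum>\<^sub>\<infinity>(i, j)\<in>P. \<Sum>\<^sub>\<infinity>k\<in>K. ennreal (f i j k)"
  show ?thesis
  proof (rule that[of "enn2real ?T"])
    fix F G assume F: "finite F" "F \<subseteq> P" and G: "finite G" "G \<subseteq> K"
    have "ennreal (\<Sum>(i, j)\<in>F. \<Sum>k\<in>G. f i j k) = (\<Sum>(i, j)\<in>F. \<Sum>k\<in>G. ennreal (f i j k))"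
      using nn by (simp add: sum_nonneg case_prod_beta flip: sum_ennreal)
    also have "\<dots> \<le> (\<Sum>(i, j)\<in>F. \<Sum>\<^sub>\<infinity>k\<in>K. ennreal (f i j k))"
      by (rule sum_mono) (use G in \<open>auto intro: finite_sum_le_infsum_ennreal\<close>)
    also have "\<dots> \<le> ?T"
      using F by (rule finite_sum_le_infsum_ennreal)
    also have "?T = ennreal (enn2real ?T)" using fin by simp
    finally show "(\<Sum>(i, j)\<in>F. \<Sum>k\<in>G. f i j k) \<le> enn2real ?T"
      by (subst (asm) ennreal_le_iff) auto
  qed
qed

text \<open>
  By monotone convergence the series of the \<open>Z m\<close> has finite expectation, so it converges almost surely
  and its terms tend to 0.
\<close>
lemma AE_tendsto_zero_of_bounded_integral_sums:
  fixes Z :: "nat \<Rightarrow> 'a \<Rightarrow> real"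
  assumes int: "\<And>m. integrable M (Z m)" and nn: "\<And>m \<omega>. Z m \<omega> \<ge> 0"
    and bd: "\<And>N. (\<Sum>m<N. \<integral>\<omega>. Z m \<omega> \<partial>M) \<le> K"
  shows "AE \<omega> in M. (\<lambda>m. Z m \<omega>) \<longlonglongrightarrow> 0"
proof -
  have nns: "(\<Sum>m. \<integral>\<^sup>+\<omega>. ennreal (Z m \<omega>) \<partial>M) < \<infinity>"
  proof -
    have "(\<Sum>m. \<integral>\<^sup>+\<omega>. ennreal (Z m \<omega>) \<partial>M) = (\<Sum>m. ennreal (\<integral>\<omega>. Z m \<omega> \<partial>M))"
      using int nn by (simp add: nn_integral_eq_integral)
    also have "\<dots> = ennreal (\<Sum>m. \<integral>\<omega>. Z m \<omega> \<partial>M)"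
      using nn bd by (intro suminf_ennreal2 summableI_nonneg_bounded[where x = K]) auto
    finally show ?thesis by simp
  qed
  have meas: "Z m \<in> borel_measurable M" for m using int by auto
  have "(\<integral>\<^sup>+\<omega>. (\<Sum>m. ennreal (Z m \<omega>)) \<partial>M) < \<infinity>"
    using nns meas by (subst nn_integral_suminf) auto
  then have "AE \<omega> in M. (\<Sum>m. ennreal (Z m \<omega>)) \<noteq> \<infinity>"
    using meas by (intro nn_integral_PInf_AE) auto
  then show ?thesis
  proof eventually_elim
    case (elim \<omega>)
    then have "summable (\<lambda>m. Z m \<omega>)" using nn by (intro summable_suminf_not_top) auto
    then show ?case by (rule summable_LIMSEQ_zero)
  qed
qed

section \<open>The strong law for a dominated sequence\<close>

lemma abs_trunc: "L \<ge> 0 \<Longrightarrow> \<bar>trunc L t\<bar> = min \<bar>t\<bar> L"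
  by (auto simp: trunc_def)

lemma abs_minus_trunc: "L \<ge> 0 \<Longrightarrow> \<bar>t - trunc L t\<bar> = max 0 (\<bar>t\<bar> - L)"
  by (auto simp: trunc_def)

lemma trunc_diff_le_excess: "0 \<le> L \<Longrightarrow> L \<le> K \<Longrightarrow> trunc_diff L K t \<le> max 0 (\<bar>t\<bar> - L)"
  unfolding trunc_diff_def trunc_def max_def min_def by (smt (verit))

lemma trunc_diff_le_min: "0 \<le> L \<Longrightarrow> L \<le> K \<Longrightarrow> trunc_diff L K t \<le> min \<bar>t\<bar> K"
  unfolding trunc_diff_def trunc_def max_def min_def by (smt (verit))

lemma trunc_diff_nonneg: "trunc_diff L K t \<ge> 0"
  by (simp add: trunc_diff_def)

lemma measurable_trunc [measurable]: "trunc L \<in> borel_measurable borel"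
  unfolding trunc_def[abs_def] by measurable

lemma measurable_trunc_diff [measurable]: "trunc_diff L K \<in> borel_measurable borel"
  unfolding trunc_diff_def[abs_def] by measurable

text \<open>
  The domination constant is made explicit, so that every estimate below can be stated with it.
\<close>
locale dominated_sequence = prob_space M for M :: "'a measure" +
  fixes X :: "nat \<Rightarrow> 'a \<Rightarrow> real" and Y :: "'a \<Rightarrow> real" and C :: real and r :: nat and p :: real
  assumes X_measurable: "\<And>i. i \<ge> 1 \<Longrightarrow> X i \<in> borel_measurable M"
    and Y_measurable [measurable]: "Y \<in> borel_measurable M"
    and C_nonneg: "C \<ge> 0"
    and tail_le: "\<And>i t. i \<ge> 1 \<Longrightarrow> t > 0 \<Longrightarrow>
      prob {\<omega> \<in> space M. \<bar>X i \<omega>\<bar> > t} \<le> C * prob {\<omega> \<in> space M. \<bar>Y \<omega>\<bar> > t}"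
    and Y_powr_integrable: "integrable M (\<lambda>\<omega>. \<bar>Y \<omega>\<bar> powr p)"
    and r_gt_1: "r > 1" and p_ge_1: "p \<ge> 1" and p_less_2: "p < 2"
begin

definition level :: "nat \<Rightarrow> real" where
  "level k = real r powr (real k / p)"

definition low :: "nat \<Rightarrow> nat \<Rightarrow> 'a \<Rightarrow> real" where
  "low k i \<omega> = trunc (level k) (X i \<omega>)"

definition layer :: "nat \<Rightarrow> nat \<Rightarrow> 'a \<Rightarrow> real" where
  "layer k i \<omega> = trunc_diff (level k) (level (Suc k)) (X i \<omega>)"

definition moment :: "nat \<Rightarrow> real" where
  "moment k = expectation (\<lambda>\<omega>. (min \<bar>Y \<omega>\<bar> (level k))\<^sup>2)"

text \<open>
  Scaled so that \<open>level k * bias k\<close> bounds \<open>r ^ k\<close> times the mean excess of any \<open>X i\<close> over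
  \<open>level k\<close>, which is the most that truncation at \<open>level k\<close> can change the means of \<open>r ^ k\<close>
  variables in total.
\<close>
definition bias :: "nat \<Rightarrow> real" where
  "bias k = C * (real r powr (real k * (1 - 1 / p)) * expectation (\<lambda>\<omega>. max 0 (\<bar>Y \<omega>\<bar> - level k)))"

definition energy :: "nat \<Rightarrow> nat \<Rightarrow> 'a \<Rightarrow> real" where
  "energy k m \<omega> = block_energy r k m (\<lambda>i. low k i \<omega> - expectation (low k i)) (\<lambda>i. layer k i \<omega> - expectation (layer k i))"

lemma level_pos: "level k > 0"
  using r_gt_1 by (simp add: level_def)

lemma level_mono: "k \<le> l \<Longrightarrow> level k \<le> level l"
  using r_gt_1 p_ge_1 by (auto simp: level_def intro!: powr_mono divide_right_mono)

lemma Y_integrable: "integrable M (\<lambda>\<omega>. \<bar>Y \<omega>\<bar>)"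
proof (rule Bochner_Integration.integrable_bound)
  show "integrable M (\<lambda>\<omega>. 1 + \<bar>Y \<omega>\<bar> powr p)"
    using Y_powr_integrable by simp
  show "AE \<omega> in M. norm \<bar>Y \<omega>\<bar> \<le> norm (1 + \<bar>Y \<omega>\<bar> powr p)"
  proof (rule AE_I2)
    fix \<omega>
    have "\<bar>Y \<omega>\<bar> \<le> 1 + \<bar>Y \<omega>\<bar> powr p"
    proof (cases "\<bar>Y \<omega>\<bar> \<le> 1")
      case False
      then have "\<bar>Y \<omega>\<bar> powr 1 \<le> \<bar>Y \<omega>\<bar> powr p" using p_ge_1 by (intro powr_mono) auto
      then show ?thesis using False by simp
    qed (use powr_ge_zero[of "\<bar>Y \<omega>\<bar>" p] in linarith)
    then show "norm \<bar>Y \<omega>\<bar> \<le> norm (1 + \<bar>Y \<omega>\<bar> powr p)" by simp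
  qed
qed simp

lemma excess_expectation_le:
  assumes "i \<ge> 1"
  shows "integrable M (\<lambda>\<omega>. max 0 (\<bar>X i \<omega>\<bar> - level k))"
    and "real (r ^ k) * expectation (\<lambda>\<omega>. max 0 (\<bar>X i \<omega>\<bar> - level k)) \<le> level k * bias k"
proof -
  note * = tail_excess_le[OF X_measurable[OF assms] Y_measurable C_nonneg less_imp_le[OF level_pos] tail_le[OF assms] Y_integrable]
  show "integrable M (\<lambda>\<omega>. max 0 (\<bar>X i \<omega>\<bar> - level k))" by (rule *(1))
  have "real (r ^ k) * expectation (\<lambda>\<omega>. max 0 (\<bar>X i \<omega>\<bar> - level k))
     \<le> real (r ^ k) * (C * expectation (\<lambda>\<omega>. max 0 (\<bar>Y \<omega>\<bar> - level k)))"
    by (rule mult_left_mono[OF *(2)]) auto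
  also have "\<dots> = level k * bias k"
  proof -
    have "real (r ^ k) = level k * real r powr (real k * (1 - 1 / p))"
      using r_gt_1 by (simp add: level_def powr_realpow[symmetric] powr_add[symmetric] algebra_simps)
    then show ?thesis by (simp only: bias_def mult_ac)
  qed
  finally show "real (r ^ k) * expectation (\<lambda>\<omega>. max 0 (\<bar>X i \<omega>\<bar> - level k)) \<le> level k * bias k" .
qed

lemma X_integrable: "i \<ge> 1 \<Longrightarrow> integrable M (X i)"
proof (rule Bochner_Integration.integrable_bound)
  assume i: "i \<ge> 1"
  show "integrable M (\<lambda>\<omega>. level 0 + max 0 (\<bar>X i \<omega>\<bar> - level 0))"
    using excess_expectation_le(1)[OF i] by simp
qed (use level_pos[of 0] X_measurable in \<open>auto intro!: AE_I2\<close>)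

lemma bias_tendsto_zero: "bias \<longlonglongrightarrow> 0"
proof -
  have "(\<lambda>k. real r powr (real k * (1 - 1 / p)) * expectation (\<lambda>\<omega>. max 0 (\<bar>Y \<omega>\<bar> - level k))) \<longlonglongrightarrow> 0"
    unfolding level_def using r_gt_1 p_ge_1 Y_powr_integrable
    by (intro scaled_tail_excess_tendsto_zero) auto
  from tendsto_mult_right_zero[OF this, of C] show ?thesis
    by (simp add: bias_def[abs_def])
qed

lemma low_measurable: "i \<ge> 1 \<Longrightarrow> low k i \<in> borel_measurable M"
  using X_measurable[of i] unfolding low_def[abs_def] by measurable

lemma layer_measurable: "i \<ge> 1 \<Longrightarrow> layer k i \<in> borel_measurable M"
  using X_measurable[of i] unfolding layer_def[abs_def] by measurable

lemma abs_low_le: "\<bar>low k i \<omega>\<bar> \<le> min \<bar>X i \<omega>\<bar> (level (Suc k))"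
  using level_mono[of k "Suc k"] level_pos[of k] by (simp add: low_def abs_trunc)

lemma abs_layer_le: "\<bar>layer k i \<omega>\<bar> \<le> min \<bar>X i \<omega>\<bar> (level (Suc k))"
  using trunc_diff_le_min[of "level k" "level (Suc k)"] level_mono[of k "Suc k"] level_pos[of k]
  by (simp add: layer_def trunc_diff_nonneg)

lemma low_integrable: "i \<ge> 1 \<Longrightarrow> integrable M (low k i)"
  using low_measurable abs_low_le[of k i]
  by (intro integrable_const_bound[where B = "level (Suc k)"]) auto

lemma layer_integrable: "i \<ge> 1 \<Longrightarrow> integrable M (layer k i)"
  using layer_measurable abs_layer_le[of k i]
  by (intro integrable_const_bound[where B = "level (Suc k)"]) auto

lemma truncated_X_second_moment:
  assumes "i \<ge> 1"
  shows "integrable M (\<lambda>\<omega>. (min \<bar>X i \<omega>\<bar> (level k))\<^sup>2)"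
    and "expectation (\<lambda>\<omega>. (min \<bar>X i \<omega>\<bar> (level k))\<^sup>2) \<le> C * moment k"
proof -
  show "integrable M (\<lambda>\<omega>. (min \<bar>X i \<omega>\<bar> (level k))\<^sup>2)"
    using X_measurable[OF assms] level_pos[of k]
    by (intro integrable_const_bound[where B = "(level k)\<^sup>2"]) (auto intro!: AE_I2 power_mono)
  show "expectation (\<lambda>\<omega>. (min \<bar>X i \<omega>\<bar> (level k))\<^sup>2) \<le> C * moment k"
    unfolding moment_def
    by (rule truncated_second_moment_le[OF X_measurable[OF assms] Y_measurable C_nonneg level_pos tail_le[OF assms]])
qed

lemma second_moment_le_of_abs_le:
  assumes i: "i \<ge> 1" and W: "W \<in> borel_measurable M" "\<And>\<omega>. \<bar>W \<omega>\<bar> \<le> min \<bar>X i \<omega>\<bar> (level k)"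
  shows "expectation (\<lambda>\<omega>. (W \<omega>)\<^sup>2) \<le> C * moment k"
proof -
  have le: "(W \<omega>)\<^sup>2 \<le> (min \<bar>X i \<omega>\<bar> (level k))\<^sup>2" for \<omega>
    using W(2)[of \<omega>] by (metis abs_ge_zero power2_abs power_mono)
  have "expectation (\<lambda>\<omega>. (W \<omega>)\<^sup>2) \<le> expectation (\<lambda>\<omega>. (min \<bar>X i \<omega>\<bar> (level k))\<^sup>2)"
    using W(1) le
    by (intro integral_mono truncated_X_second_moment(1)[OF i]
          Bochner_Integration.integrable_bound[OF truncated_X_second_moment(1)[OF i, of k]]) auto
  also have "\<dots> \<le> C * moment k" by (rule truncated_X_second_moment(2)[OF i])
  finally show ?thesis .
qed

lemma moment_nonneg: "moment k \<ge> 0"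
  by (simp add: moment_def)

lemma moment_sums_bounded:
  obtains B where "\<And>N. (\<Sum>k<N. real r powr ((1 - 2 / p) * real k) * moment k) \<le> B"
proof -
  obtain c where c: "c > 0" "\<And>y N. 0 \<le> y \<Longrightarrow>
       (\<Sum>k<N. real r powr ((1 - 2 / p) * real k) * (min y (real r powr (real k / p)))\<^sup>2) \<le> c * y powr p"
    using sum_truncated_squares_le_powr[of "real r" p] r_gt_1 p_ge_1 p_less_2 by auto
  show ?thesis
  proof (rule that[of "c * expectation (\<lambda>\<omega>. \<bar>Y \<omega>\<bar> powr p)"])
    fix N
    have int: "integrable M (\<lambda>\<omega>. (min \<bar>Y \<omega>\<bar> (level k))\<^sup>2)" for k
      using level_pos[of k]
      by (intro integrable_const_bound[where B = "(level k)\<^sup>2"]) (auto intro!: AE_I2 power_mono)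
    have "(\<Sum>k<N. real r powr ((1 - 2 / p) * real k) * moment k)
        = expectation (\<lambda>\<omega>. \<Sum>k<N. real r powr ((1 - 2 / p) * real k) * (min \<bar>Y \<omega>\<bar> (level k))\<^sup>2)"
      using int by (simp add: moment_def)
    also have "\<dots> \<le> expectation (\<lambda>\<omega>. c * \<bar>Y \<omega>\<bar> powr p)"
      using c(2) int Y_powr_integrable
      by (intro integral_mono Bochner_Integration.integrable_sum) (auto simp: level_def)
    finally show "(\<Sum>k<N. real r powr ((1 - 2 / p) * real k) * moment k) \<le> c * expectation (\<lambda>\<omega>. \<bar>Y \<omega>\<bar> powr p)"
      by simp
  qed
qed

text \<open>
  The quotient \<open>(min \<bar>X i\<bar> (level m))\<^sup>2 / (level m)\<^sup>2\<close> equals 1 wherever \<open>\<bar>X i\<bar>\<close> exceeds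
  \<open>level m\<close>. Its expectations, summed over \<open>i \<le> r ^ m\<close> and then over \<open>m\<close>, are bounded by the series
  of truncated second moments of \<open>Y\<close> that also governs the diagonal terms.
\<close>
lemma AE_eventually_below_level:
  "AE \<omega> in M. \<forall>\<^sub>F m in sequentially. \<forall>i\<in>{0<..r ^ m}. \<bar>X i \<omega>\<bar> \<le> level m"
proof -
  define Z where "Z m \<omega> = (\<Sum>i\<in>{0<..r ^ m}. (min \<bar>X i \<omega>\<bar> (level m))\<^sup>2) / (level m)\<^sup>2" for m \<omega>
  obtain B where B: "\<And>N. (\<Sum>k<N. real r powr ((1 - 2 / p) * real k) * moment k) \<le> B"
    using moment_sums_bounded by blast
  have "AE \<omega> in M. (\<lambda>m. Z m \<omega>) \<longlonglongrightarrow> 0"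
  proof (rule AE_tendsto_zero_of_bounded_integral_sums[where K = "C * B"])
    show "integrable M (Z m)" for m
      unfolding Z_def by (intro integrable_divide_zero Bochner_Integration.integrable_sum truncated_X_second_moment) auto
    show "Z m \<omega> \<ge> 0" for m \<omega> unfolding Z_def by (intro divide_nonneg_nonneg sum_nonneg) auto
    fix N
    have "expectation (Z m) \<le> C * (real r powr ((1 - 2 / p) * real m) * moment m)" for m
    proof -
      have "expectation (Z m) = (\<Sum>i\<in>{0<..r ^ m}. expectation (\<lambda>\<omega>. (min \<bar>X i \<omega>\<bar> (level m))\<^sup>2)) / (level m)\<^sup>2"
        unfolding Z_def using truncated_X_second_moment(1) by simp
      also have "\<dots> \<le> (\<Sum>i\<in>{0<..r ^ m}. C * moment m) / (level m)\<^sup>2"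
        using truncated_X_second_moment(2) by (intro divide_right_mono sum_mono) auto
      also have "\<dots> = C * (real r ^ m / (level m)\<^sup>2 * moment m)" by simp
      also have "real r ^ m / (level m)\<^sup>2 = real r powr ((1 - 2 / p) * real m)"
      proof -
        have "(level m)\<^sup>2 = real r powr (2 / p * real m)"
          by (simp add: level_def powr_powr mult.commute flip: powr_numeral)
        moreover have "real r ^ m = real r powr real m" using r_gt_1 by (simp add: powr_realpow)
        ultimately show ?thesis using r_gt_1 by (simp add: left_diff_distrib flip: powr_diff)
      qed
      finally show ?thesis .
    qed
    then have "(\<Sum>m<N. expectation (Z m)) \<le> C * (\<Sum>m<N. real r powr ((1 - 2 / p) * real m) * moment m)"
      unfolding sum_distrib_left by (rule sum_mono)
    also have "\<dots> \<le> C * B" using B C_nonneg by (intro mult_left_mono) auto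
    finally show "(\<Sum>m<N. expectation (Z m)) \<le> C * B" .
  qed
  then show ?thesis
  proof eventually_elim
    case (elim \<omega>)
    then have "\<forall>\<^sub>F m in sequentially. Z m \<omega> < 1" by (rule order_tendstoD) simp
    then show ?case
    proof eventually_elim
      case (elim m)
      show ?case
      proof (rule ccontr)
        assume "\<not> (\<forall>i\<in>{0<..r ^ m}. \<bar>X i \<omega>\<bar> \<le> level m)"
        then obtain i where i: "i \<in> {0<..r ^ m}" "\<bar>X i \<omega>\<bar> > level m" by force
        have "(min \<bar>X i \<omega>\<bar> (level m))\<^sup>2 \<le> (\<Sum>i\<in>{0<..r ^ m}. (min \<bar>X i \<omega>\<bar> (level m))\<^sup>2)"
          by (rule member_le_sum[OF i(1)]) auto
        with i have "(level m)\<^sup>2 \<le> (\<Sum>i\<in>{0<..r ^ m}. (min \<bar>X i \<omega>\<bar> (level m))\<^sup>2)" by (simp add: min_def)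
        with elim level_pos[of m] show False by (simp add: Z_def field_simps)
      qed
    qed
  qed
qed

text \<open>
  The increment of the truncations is a layer in absolute value. Centring the layer leaves twice its
  mean, which is at most the mean excess over \<open>level k\<close>.
\<close>
lemma low_increment_le:
  assumes "i \<ge> 1"
  shows "\<bar>(low (Suc k) i \<omega> - expectation (low (Suc k) i)) - (low k i \<omega> - expectation (low k i))\<bar>
      \<le> (layer k i \<omega> - expectation (layer k i)) + 2 * (level k * bias k / real (r ^ k))"
proof -
  have layer: "\<bar>low (Suc k) i \<omega> - low k i \<omega>\<bar> = layer k i \<omega>" for \<omega>
    by (simp add: low_def layer_def trunc_diff_def)
  have "\<bar>expectation (low (Suc k) i) - expectation (low k i)\<bar> = \<bar>expectation (\<lambda>\<omega>. low (Suc k) i \<omega> - low k i \<omega>)\<bar>"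
    using low_integrable[OF assms] by simp
  also have "\<dots> \<le> expectation (layer k i)"
    using integral_abs_bound[of M "\<lambda>\<omega>. low (Suc k) i \<omega> - low k i \<omega>"] by (simp add: layer)
  finally have 1: "\<bar>expectation (low (Suc k) i) - expectation (low k i)\<bar> \<le> expectation (layer k i)" .
  have "expectation (layer k i) \<le> expectation (\<lambda>\<omega>. max 0 (\<bar>X i \<omega>\<bar> - level k))"
    using trunc_diff_le_excess[of "level k" "level (Suc k)"] level_mono[of k "Suc k"] level_pos[of k]
    by (intro integral_mono layer_integrable excess_expectation_le assms) (auto simp: layer_def)
  also have "\<dots> \<le> level k * bias k / real (r ^ k)"
    using excess_expectation_le(2)[OF assms, of k] r_gt_1 by (simp add: field_simps)
  finally show ?thesis using 1 layer[of \<omega>] by linarith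
qed

lemma centred_sum_minus_low_le:
  assumes n: "n \<le> r ^ m" and below: "\<forall>i\<in>{0<..r ^ m}. \<bar>X i \<omega>\<bar> \<le> level m"
  shows "\<bar>\<Sum>i\<in>{0<..n}. X i \<omega> - expectation (X i)\<bar>
     \<le> \<bar>\<Sum>i\<in>{0<..n}. low m i \<omega> - expectation (low m i)\<bar> + level m * bias m"
proof -
  have "\<bar>(X i \<omega> - expectation (X i)) - (low m i \<omega> - expectation (low m i))\<bar>
      \<le> level m * bias m / real (r ^ m)" if i: "i \<in> {0<..n}" for i
  proof -
    have i1: "i \<ge> 1" using i by simp
    have "\<bar>X i \<omega>\<bar> \<le> level m" using i n below by auto
    then have "low m i \<omega> = X i \<omega>" by (auto simp: low_def trunc_def abs_le_iff)
    then have "\<bar>(X i \<omega> - expectation (X i)) - (low m i \<omega> - expectation (low m i))\<bar>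
        = \<bar>expectation (\<lambda>\<omega>. X i \<omega> - low m i \<omega>)\<bar>"
      using low_integrable[OF i1] X_integrable[OF i1] by simp
    also have "\<dots> \<le> expectation (\<lambda>\<omega>. \<bar>X i \<omega> - low m i \<omega>\<bar>)" by (rule integral_abs_bound)
    also have "\<dots> = expectation (\<lambda>\<omega>. max 0 (\<bar>X i \<omega>\<bar> - level m))"
      using level_pos[of m] by (simp add: low_def abs_minus_trunc)
    also have "\<dots> \<le> level m * bias m / real (r ^ m)"
      using excess_expectation_le(2)[OF i1, of m] r_gt_1 by (simp add: field_simps)
    finally show ?thesis .
  qed
  then have "(\<Sum>i\<in>{0<..n}. \<bar>(X i \<omega> - expectation (X i)) - (low m i \<omega> - expectation (low m i))\<bar>)
      \<le> (\<Sum>i\<in>{0<..n}. level m * bias m / real (r ^ m))" by (rule sum_mono)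
  also have "\<dots> = real n * (level m * bias m / real (r ^ m))" by simp
  also have "\<dots> \<le> real (r ^ m) * (level m * bias m / real (r ^ m))"
  proof (intro mult_right_mono)
    show "0 \<le> level m * bias m / real (r ^ m)"
      using level_pos[of m] C_nonneg r_gt_1
      by (auto simp: bias_def intro!: divide_nonneg_nonneg mult_nonneg_nonneg)
  qed (use n in \<open>simp del: of_nat_power\<close>)
  also have "\<dots> = level m * bias m" using r_gt_1 by simp
  finally have "\<bar>(\<Sum>i\<in>{0<..n}. (X i \<omega> - expectation (X i)) - (low m i \<omega> - expectation (low m i)))\<bar> \<le> level m * bias m"
    by (rule order_trans[OF sum_abs])
  then show ?thesis unfolding sum_subtractf by linarith
qed

text \<open>
  The chaining bound at the levels \<open>level k\<close>. Since \<open>level k = level m * (r powr (- 1/p)) ^ (m - k)\<close>,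
  the biases of the scales appear as a geometric convolution.
\<close>
lemma low_sum_le_energies:
  assumes "n < r ^ m"
  shows "\<bar>\<Sum>i\<in>{0<..n}. low m i \<omega> - expectation (low m i)\<bar>
     \<le> 2 * (\<Sum>k<m. sqrt (energy k m \<omega>))
       + level m * (2 * real r * (\<Sum>k<m. (real r powr (- 1 / p)) ^ (m - k) * bias k))"
proof -
  have "\<bar>\<Sum>i\<in>{0<..n}. low m i \<omega> - expectation (low m i)\<bar>
     \<le> (\<Sum>k<m. 2 * sqrt (energy k m \<omega>) + real (r ^ Suc k) * (2 * (level k * bias k / real (r ^ k))))"
    unfolding energy_def
    by (rule partial_sum_le_block_energies[OF r_gt_1 assms]) (rule low_increment_le)
  also have "\<dots> = (\<Sum>k<m. 2 * sqrt (energy k m \<omega>)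
      + level m * (2 * real r * ((real r powr (- 1 / p)) ^ (m - k) * bias k)))"
  proof (intro sum.cong refl)
    fix k assume "k \<in> {..<m}"
    then have k: "real (m - k) = real m - real k" by simp
    have "(real r powr (- 1 / p)) ^ (m - k) = (real r powr (- 1 / p)) powr real (m - k)"
      using r_gt_1 by (simp only: powr_realpow powr_gt_zero)
    also have "\<dots> = real r powr (- 1 / p * (real m - real k))"
      unfolding k by (rule powr_powr)
    finally have "level m * (real r powr (- 1 / p)) ^ (m - k) = real r powr (real m / p + - 1 / p * (real m - real k))"
      unfolding level_def by (simp only: powr_add)
    also have "real m / p + - 1 / p * (real m - real k) = real k / p"
      using p_ge_1 by (simp add: field_simps)
    finally have "level m * (real r powr (- 1 / p)) ^ (m - k) = level k"
      unfolding level_def .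
    then have "level m * (2 * real r * ((real r powr (- 1 / p)) ^ (m - k) * bias k)) = 2 * real r * (level k * bias k)"
      by (metis mult.assoc mult.left_commute)
    moreover have "real (r ^ Suc k) * (2 * (level k * bias k / real (r ^ k))) = 2 * real r * (level k * bias k)"
      using r_gt_1 by simp
    ultimately show "2 * sqrt (energy k m \<omega>) + real (r ^ Suc k) * (2 * (level k * bias k / real (r ^ k)))
      = 2 * sqrt (energy k m \<omega>) + level m * (2 * real r * ((real r powr (- 1 / p)) ^ (m - k) * bias k))"
      by (simp only:)
  qed
  finally show ?thesis by (simp add: sum.distrib sum_distrib_left)
qed

definition interaction :: "nat \<Rightarrow> nat \<Rightarrow> nat \<Rightarrow> real" where
  "interaction k i j = max 0 (G_cov M (X i) (X j) (level k))
     + max 0 (H_cov M (X i) (X j) (level k) (level (Suc k)))"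

lemma interaction_nonneg: "interaction k i j \<ge> 0"
  by (simp add: interaction_def)

lemma energy_nonneg: "energy k m \<omega> \<ge> 0"
  unfolding energy_def by (rule block_energy_nonneg)

lemma expected_energy_le:
  assumes "k < m"
  shows "integrable M (energy k m)"
    and "expectation (energy k m) \<le> 2 * real r *
      (C * real r powr real m * moment (Suc k)
       + (\<Sum>(i, j)\<in>index_pairs {0<..r ^ m}. interaction k i j))"
proof -
  have bd: "\<bar>low k i \<omega>\<bar> \<le> level (Suc k)" "\<bar>layer k i \<omega>\<bar> \<le> level (Suc k)" for i \<omega>
    using abs_low_le[of k i \<omega>] abs_layer_le[of k i \<omega>] by auto
  note * = expected_block_energy_le[where U = "low k" and V = "layer k",
      OF r_gt_1 assms low_measurable layer_measurable bd, folded energy_def[abs_def]]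
  show "integrable M (energy k m)"
    using *(1) by (simp add: energy_def[abs_def])
  have "expectation (energy k m) \<le> real r *
      ((\<Sum>i\<in>{0<..r ^ m}. expectation (\<lambda>\<omega>. (low k i \<omega>)\<^sup>2) + expectation (\<lambda>\<omega>. (layer k i \<omega>)\<^sup>2))
       + 2 * (\<Sum>(i, j)\<in>index_pairs {0<..r ^ m}.
                max 0 (covariance M (low k i) (low k j)) + max 0 (covariance M (layer k i) (layer k j))))"
    using *(2) by (simp add: energy_def[abs_def])
  also have "\<dots> \<le> real r *
      ((\<Sum>i\<in>{0<..r ^ m}. C * moment (Suc k) + C * moment (Suc k))
       + 2 * (\<Sum>(i, j)\<in>index_pairs {0<..r ^ m}. interaction k i j))"
  proof (intro mult_left_mono add_mono sum_mono)
    fix i assume "i \<in> {0<..r ^ m}"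
    then have i: "i \<ge> 1" by simp
    show "expectation (\<lambda>\<omega>. (low k i \<omega>)\<^sup>2) \<le> C * moment (Suc k)"
      by (rule second_moment_le_of_abs_le[OF i low_measurable[OF i] abs_low_le])
    show "expectation (\<lambda>\<omega>. (layer k i \<omega>)\<^sup>2) \<le> C * moment (Suc k)"
      by (rule second_moment_le_of_abs_le[OF i layer_measurable[OF i] abs_layer_le])
  qed (auto simp: interaction_def G_cov_def H_cov_def low_def[abs_def] layer_def[abs_def])
  also have "\<dots> = 2 * real r * (C * real r powr real m * moment (Suc k)
       + (\<Sum>(i, j)\<in>index_pairs {0<..r ^ m}. interaction k i j))"
    using r_gt_1 by (simp add: powr_realpow algebra_simps)
  finally show "expectation (energy k m) \<le> 2 * real r *
      (C * real r powr real m * moment (Suc k)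
       + (\<Sum>(i, j)\<in>index_pairs {0<..r ^ m}. interaction k i j))" .
qed

text \<open>
  The expectations are summable over \<open>m\<close>: the diagonal parts by the truncated moments of \<open>Y\<close>, the
  off-diagonal ones by the assumed bound. The factor \<open>r powr m\<close> counting the diagonal terms is what turns
  the weight \<open>r powr (- 2m/\<alpha>)\<close> into \<open>r powr ((1 - 2/\<alpha>) m)\<close>.
\<close>
lemma AE_weighted_energy_tendsto_zero:
  fixes \<alpha> W :: real
  assumes \<alpha>: "0 < \<alpha>" "\<alpha> < 2"
    and W: "\<And>N. (\<Sum>(i, j)\<in>index_pairs {0<..r ^ N}. \<Sum>k<N.
        real r powr (- (2 / \<alpha>) * max (real (Suc k)) (log (real r) (real j)))
          * (real r powr (- (2 / p - 2 / \<alpha>) * real (Suc k)) * interaction k i j)) \<le> W"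
  shows "AE \<omega> in M. (\<lambda>m. real r powr (- (2 / \<alpha>) * real m)
      * (\<Sum>k<m. real r powr (- (2 / p - 2 / \<alpha>) * real (Suc k)) * energy k m \<omega>)) \<longlonglongrightarrow> 0"
proof -
  let ?u = "\<lambda>m::nat. real r powr (- (2 / \<alpha>) * real m)"
  let ?a = "\<lambda>k::nat. real r powr (- (2 / p - 2 / \<alpha>) * real (Suc k))"
  obtain B where B: "\<And>N. (\<Sum>k<N. real r powr ((1 - 2 / p) * real k) * moment k) \<le> B"
    using moment_sums_bounded by blast
  obtain c1 where c1: "c1 > 0" "\<And>N \<mu>. (\<And>k. \<mu> k \<ge> 0) \<Longrightarrow>
     (\<Sum>m<N. real r powr ((1 - 2 / \<alpha>) * real m) * (\<Sum>k<m. ?a k * \<mu> (Suc k)))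
       \<le> c1 * (\<Sum>k<Suc N. real r powr ((1 - 2 / p) * real k) * \<mu> k)"
    using sum_diagonal_le[of "real r" \<alpha> p] r_gt_1 \<alpha> by auto
  obtain c2 where c2: "c2 > 0" "\<And>N a w. \<lbrakk>\<And>k. a k \<ge> 0; \<And>k i j. w k i j \<ge> 0\<rbrakk> \<Longrightarrow>
     (\<Sum>m<N. ?u m * (\<Sum>k<m. a k * (\<Sum>(i, j)\<in>index_pairs {0<..r ^ m}. w k i j)))
       \<le> c2 * (\<Sum>(i, j)\<in>index_pairs {0<..r ^ N}. \<Sum>k<N.
               real r powr (- (2 / \<alpha>) * max (real (Suc k)) (log (real r) (real j))) * (a k * w k i j))"
    using sum_off_diagonal_le[OF r_gt_1 \<alpha>(1)] by blast
  have distr: "u * (\<Sum>k<m. a k * (K * (D * R * \<mu> k + w k)))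
      = K * (D * ((u * R) * (\<Sum>k<m. a k * \<mu> k)) + u * (\<Sum>k<m. a k * w k))"
    for u K D R :: real and a \<mu> w :: "nat \<Rightarrow> real" and m
    by (simp add: distrib_left sum.distrib sum_distrib_left mult_ac)
  show ?thesis
  proof (rule AE_tendsto_zero_of_bounded_integral_sums[where K = "2 * real r * (C * (c1 * B) + c2 * W)"])
    show "integrable M (\<lambda>\<omega>. ?u m * (\<Sum>k<m. ?a k * energy k m \<omega>))" for m
      using expected_energy_le(1)
      by (intro integrable_mult_right Bochner_Integration.integrable_sum) auto
    show "0 \<le> ?u m * (\<Sum>k<m. ?a k * energy k m \<omega>)" for m \<omega>
      by (intro mult_nonneg_nonneg sum_nonneg energy_nonneg) auto
    fix N
    have "expectation (\<lambda>\<omega>. ?u m * (\<Sum>k<m. ?a k * energy k m \<omega>))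
      \<le> 2 * real r * (C * (real r powr ((1 - 2 / \<alpha>) * real m) * (\<Sum>k<m. ?a k * moment (Suc k)))
          + ?u m * (\<Sum>k<m. ?a k * (\<Sum>(i, j)\<in>index_pairs {0<..r ^ m}. interaction k i j)))" for m
    proof -
      have "expectation (\<lambda>\<omega>. ?u m * (\<Sum>k<m. ?a k * energy k m \<omega>))
          = ?u m * (\<Sum>k<m. ?a k * expectation (energy k m))"
        using expected_energy_le(1) by simp
      also have "\<dots> \<le> ?u m * (\<Sum>k<m. ?a k * (2 * real r * (C * real r powr real m * moment (Suc k)
       + (\<Sum>(i, j)\<in>index_pairs {0<..r ^ m}. interaction k i j))))"
        using expected_energy_le(2) by (intro mult_left_mono sum_mono) auto
      also have "\<dots> = 2 * real r * (C * ((?u m * real r powr real m) * (\<Sum>k<m. ?a k * moment (Suc k)))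
          + ?u m * (\<Sum>k<m. ?a k * (\<Sum>(i, j)\<in>index_pairs {0<..r ^ m}. interaction k i j)))"
        by (rule distr)
      also have "?u m * real r powr real m = real r powr ((1 - 2 / \<alpha>) * real m)"
        by (simp add: algebra_simps flip: powr_add)
      finally show ?thesis .
    qed
    then have "(\<Sum>m<N. expectation (\<lambda>\<omega>. ?u m * (\<Sum>k<m. ?a k * energy k m \<omega>)))
      \<le> (\<Sum>m<N. 2 * real r * (C * (real r powr ((1 - 2 / \<alpha>) * real m) * (\<Sum>k<m. ?a k * moment (Suc k)))
          + ?u m * (\<Sum>k<m. ?a k * (\<Sum>(i, j)\<in>index_pairs {0<..r ^ m}. interaction k i j))))"
      by (rule sum_mono)
    also have "\<dots> = 2 * real r * (C * (\<Sum>m<N. real r powr ((1 - 2 / \<alpha>) * real m) * (\<Sum>k<m. ?a k * moment (Suc k)))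
          + (\<Sum>m<N. ?u m * (\<Sum>k<m. ?a k * (\<Sum>(i, j)\<in>index_pairs {0<..r ^ m}. interaction k i j))))"
      by (simp only: sum_distrib_left[symmetric] sum.distrib)
    also have "\<dots> \<le> 2 * real r * (C * (c1 * B) + c2 * W)"
    proof (intro mult_left_mono add_mono)
      show "(\<Sum>m<N. real r powr ((1 - 2 / \<alpha>) * real m) * (\<Sum>k<m. ?a k * moment (Suc k))) \<le> c1 * B"
        by (rule order_trans[OF c1(2)[OF moment_nonneg] mult_left_mono[OF B]]) (use c1 in simp)
      show "(\<Sum>m<N. ?u m * (\<Sum>k<m. ?a k * (\<Sum>(i, j)\<in>index_pairs {0<..r ^ m}. interaction k i j))) \<le> c2 * W"
        by (rule order_trans[OF c2(2) mult_left_mono[OF W]]) (use c2 interaction_nonneg in auto)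
    qed (use C_nonneg in auto)
    finally show "(\<Sum>m<N. expectation (\<lambda>\<omega>. ?u m * (\<Sum>k<m. ?a k * energy k m \<omega>)))
        \<le> 2 * real r * (C * (c1 * B) + c2 * W)" .
  qed
qed

text \<open>
  For \<open>n < r ^ m\<close> the centred sum, divided by \<open>level m\<close>, is bounded by three null sequences: the
  energies of the chaining blocks, after Cauchy-Schwarz over the scales; the biases accumulated along the
  chain; and the bias of the final truncation at \<open>level m\<close>.
\<close>
lemma strong_law_if_interactions_bounded:
  fixes \<alpha> W :: real
  assumes \<alpha>: "p < \<alpha>" "\<alpha> < 2"
    and W: "\<And>N. (\<Sum>(i, j)\<in>index_pairs {0<..r ^ N}. \<Sum>k<N.
        real r powr (- (2 / \<alpha>) * max (real (Suc k)) (log (real r) (real j)))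
          * (real r powr (- (2 / p - 2 / \<alpha>) * real (Suc k)) * interaction k i j)) \<le> W"
  shows "AE \<omega> in M. (\<lambda>n. 1 / real n powr (1 / p) * (\<Sum>i\<in>{0<..n}. X i \<omega> - expectation (X i))) \<longlonglongrightarrow> 0"
proof -
  define Z where "Z m \<omega> = real r powr (- (2 / \<alpha>) * real m)
      * (\<Sum>k<m. real r powr (- (2 / p - 2 / \<alpha>) * real (Suc k)) * energy k m \<omega>)" for m \<omega>
  have \<gamma>: "2 / p - 2 / \<alpha> > 0" using \<alpha> p_ge_1 by (simp add: field_simps)
  obtain c where c: "c > 0" "\<And>m Q. (\<And>k. Q k \<ge> 0) \<Longrightarrow>
     (\<Sum>k<m. sqrt (Q k))\<^sup>2 \<le> c * (real r powr ((2 / p - 2 / \<alpha>) * real m)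
        * (\<Sum>k<m. real r powr (- (2 / p - 2 / \<alpha>) * real (Suc k)) * Q k))"
    using square_sum_sqrt_le_weighted[OF _ \<gamma>, of "real r"] r_gt_1 by auto
  have energies: "(\<Sum>k<m. sqrt (energy k m \<omega>)) \<le> level m * sqrt (c * Z m \<omega>)" for m \<omega>
  proof -
    have "real r powr ((2 / p - 2 / \<alpha>) * real m) = (level m)\<^sup>2 * real r powr (- (2 / \<alpha>) * real m)"
      by (simp add: level_def powr_powr algebra_simps power2_eq_square flip: powr_add)
    then have "(\<Sum>k<m. sqrt (energy k m \<omega>))\<^sup>2 \<le> (level m)\<^sup>2 * (c * Z m \<omega>)"
      using c(2)[of "\<lambda>k. energy k m \<omega>" m] energy_nonneg by (simp add: Z_def mult_ac)
    then have "sqrt ((\<Sum>k<m. sqrt (energy k m \<omega>))\<^sup>2) \<le> sqrt ((level m)\<^sup>2 * (c * Z m \<omega>))"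
      by (rule real_sqrt_le_mono)
    moreover have "0 \<le> (\<Sum>k<m. sqrt (energy k m \<omega>))"
      using energy_nonneg by (intro sum_nonneg) auto
    ultimately show ?thesis
      using level_pos[of m] by (simp add: real_sqrt_mult)
  qed
  define x where "x = real r powr (- 1 / p)"
  have x: "0 \<le> x" "x < 1" using r_gt_1 p_ge_1 by (auto simp: x_def powr_less_one)
  define U where "U \<omega> m = 2 * sqrt (c * Z m \<omega>) + 2 * real r * (\<Sum>k<m. x ^ (m - k) * bias k) + bias m" for \<omega> m
  have "AE \<omega> in M. (\<lambda>m. Z m \<omega>) \<longlonglongrightarrow> 0"
    unfolding Z_def using \<alpha> p_ge_1 W by (intro AE_weighted_energy_tendsto_zero[where W = W]) auto
  with AE_eventually_below_level show ?thesis
  proof eventually_elim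
    case (elim \<omega>)
    have "U \<omega> \<longlonglongrightarrow> 2 * sqrt (c * 0) + 2 * real r * 0 + 0"
      unfolding U_def
      by (intro tendsto_intros elim geometric_convolution_tendsto_zero x bias_tendsto_zero)
    then have U: "U \<omega> \<longlonglongrightarrow> 0" by simp
    show ?case
    proof (rule geometric_blocks_tendsto_zero[OF r_gt_1 _ U])
      show "\<forall>\<^sub>F m in sequentially. \<forall>n\<ge>1. n < r ^ m \<longrightarrow>
          \<bar>\<Sum>i\<in>{0<..n}. X i \<omega> - expectation (X i)\<bar> \<le> real r powr (real m / p) * U \<omega> m"
        using elim(1)
      proof eventually_elim
        case (elim m)
        show ?case
        proof (intro allI impI)
          fix n assume n: "n < r ^ m"
          have "\<bar>\<Sum>i\<in>{0<..n}. X i \<omega> - expectation (X i)\<bar>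
             \<le> \<bar>\<Sum>i\<in>{0<..n}. low m i \<omega> - expectation (low m i)\<bar> + level m * bias m"
            by (rule centred_sum_minus_low_le[OF less_imp_le[OF n] elim])
          also have "\<dots> \<le> 2 * (level m * sqrt (c * Z m \<omega>))
              + level m * (2 * real r * (\<Sum>k<m. x ^ (m - k) * bias k)) + level m * bias m"
            using low_sum_le_energies[OF n, of \<omega>] energies[of m \<omega>] unfolding x_def by linarith
          also have "\<dots> = real r powr (real m / p) * U \<omega> m"
            by (simp add: U_def level_def algebra_simps)
          finally show "\<bar>\<Sum>i\<in>{0<..n}. X i \<omega> - expectation (X i)\<bar> \<le> real r powr (real m / p) * U \<omega> m" .
        qed
      qed
    qed (use p_ge_1 in simp)
  qed
qed

end

lemma (in prob_space) stochastically_dominatedE: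
  assumes "stochastically_dominated M X Y"
  obtains C where "C > 0" "\<And>i t. i \<ge> 1 \<Longrightarrow> t > 0 \<Longrightarrow>
      prob {\<omega> \<in> space M. \<bar>X i \<omega>\<bar> > t} \<le> C * prob {\<omega> \<in> space M. \<bar>Y \<omega>\<bar> > t}"
proof -
  obtain C where C: "C > 0" "\<And>t. t > 0 \<Longrightarrow>
      (SUP n\<in>{1..}. prob {\<omega> \<in> space M. \<bar>X n \<omega>\<bar> > t}) \<le> C * prob {\<omega> \<in> space M. \<bar>Y \<omega>\<bar> > t}"
    using assms unfolding stochastically_dominated_def by blast
  show ?thesis
  proof (rule that[OF C(1)])
    fix i :: nat and t :: real assume "i \<ge> 1" "t > 0"
    have "bdd_above ((\<lambda>n. prob {\<omega> \<in> space M. \<bar>X n \<omega>\<bar> > t}) ` {1..})"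
      by (rule bdd_aboveI[where M = 1]) auto
    then have "prob {\<omega> \<in> space M. \<bar>X i \<omega>\<bar> > t} \<le> (SUP n\<in>{1..}. prob {\<omega> \<in> space M. \<bar>X n \<omega>\<bar> > t})"
      using \<open>i \<ge> 1\<close> by (intro cSUP_upper) auto
    also note C(2)[OF \<open>t > 0\<close>]
    finally show "prob {\<omega> \<in> space M. \<bar>X i \<omega>\<bar> > t} \<le> C * prob {\<omega> \<in> space M. \<bar>Y \<omega>\<bar> > t}" .
  qed
qed

theorem corollary2:
  fixes M :: "'a measure"
    and X :: "nat \<Rightarrow> 'a \<Rightarrow> real" and Y :: "'a \<Rightarrow> real"
    and r :: nat and p \<alpha> :: real
  assumes "prob_space M"
    and "r > 1"
    and "1 \<le> p" and "p < 2"
    and "\<And>n. n \<ge> 1 \<Longrightarrow> X n \<in> borel_measurable M"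
    and "Y \<in> borel_measurable M"
    and "stochastically_dominated M X Y"
    and "integrable M (\<lambda>\<omega>. \<bar>Y \<omega>\<bar> powr p)"
    and "p < \<alpha>" and "\<alpha> < 2"
    and "(\<Sum>\<^sub>\<infinity>(i, j)\<in>{(i :: nat, j :: nat). 1 \<le> i \<and> i < j}. \<Sum>\<^sub>\<infinity>k\<in>{1 :: nat..}.
            ennreal (real r powr ((2 / \<alpha> - 2 / p) * real k
                                   - 2 * max (real k) (log (real r) (real j)) / \<alpha>)
              * (max 0 (G_cov M (X i) (X j) (real r powr ((real k - 1) / p)))
                 + max 0 (H_cov M (X i) (X j) (real r powr ((real k - 1) / p))
                                              (real r powr (real k / p)))))) < \<infinity>"
  shows "AE \<omega> in M.
           (\<lambda>n. 1 / real n powr (1 / p) * (\<Sum>k=1..n. X k \<omega> - (\<integral>\<omega>'. X k \<omega>' \<partial>M)))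
             \<longlonglongrightarrow> 0"
proof -
  interpret prob_space M by fact
  obtain C where C: "C > 0" "\<And>i t. i \<ge> 1 \<Longrightarrow> t > 0 \<Longrightarrow>
      prob {\<omega> \<in> space M. \<bar>X i \<omega>\<bar> > t} \<le> C * prob {\<omega> \<in> space M. \<bar>Y \<omega>\<bar> > t}"
    using stochastically_dominatedE[OF assms(7)] by blast
  interpret dominated_sequence M X Y C r p
    using assms C by unfold_locales auto
  let ?f = "\<lambda>i j k. real r powr ((2 / \<alpha> - 2 / p) * real k - 2 * max (real k) (log (real r) (real j)) / \<alpha>)
              * (max 0 (G_cov M (X i) (X j) (real r powr ((real k - 1) / p)))
                 + max 0 (H_cov M (X i) (X j) (real r powr ((real k - 1) / p)) (real r powr (real k / p))))"
  obtain W where W: "\<And>F G. \<lbrakk>finite F; F \<subseteq> {(i, j). 1 \<le> i \<and> i < j}; finite G; G \<subseteq> {1..}\<rbrakk> \<Longrightarrow>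
      (\<Sum>(i, j)\<in>F. \<Sum>k\<in>G. ?f i j k) \<le> W"
    by (rule finite_sums_le_of_infsum_finite[where f = ?f, OF _ assms(11)]) (auto intro!: mult_nonneg_nonneg add_nonneg_nonneg)
  have "AE \<omega> in M. (\<lambda>n. 1 / real n powr (1 / p) * (\<Sum>i\<in>{0<..n}. X i \<omega> - expectation (X i))) \<longlonglongrightarrow> 0"
  proof (rule strong_law_if_interactions_bounded[where \<alpha> = \<alpha> and W = W])
    fix N
    have "real r powr (- (2 / \<alpha>) * max (real (Suc k)) (log (real r) (real j)))
          * (real r powr (- (2 / p - 2 / \<alpha>) * real (Suc k)) * interaction k i j) = ?f i j (Suc k)" for i j k
    proof -
      have "- (2 / \<alpha>) * max (real (Suc k)) (log (real r) (real j)) + - (2 / p - 2 / \<alpha>) * real (Suc k)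
          = (2 / \<alpha> - 2 / p) * real (Suc k) - 2 * max (real (Suc k)) (log (real r) (real j)) / \<alpha>"
        by (simp add: algebra_simps)
      \<comment> \<open>The scale \<open>k\<close>, counted from 0, is the term \<open>k + 1\<close> of the series.\<close>
      moreover have "interaction k i j = max 0 (G_cov M (X i) (X j) (real r powr ((real (Suc k) - 1) / p)))
                 + max 0 (H_cov M (X i) (X j) (real r powr ((real (Suc k) - 1) / p)) (real r powr (real (Suc k) / p)))"
        by (simp add: interaction_def level_def)
      ultimately show ?thesis by (simp only: mult.assoc[symmetric] powr_add[symmetric])
    qed
    then have "(\<Sum>(i, j)\<in>index_pairs {0<..r ^ N}. \<Sum>k<N.
        real r powr (- (2 / \<alpha>) * max (real (Suc k)) (log (real r) (real j)))
          * (real r powr (- (2 / p - 2 / \<alpha>) * real (Suc k)) * interaction k i j))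
      = (\<Sum>(i, j)\<in>index_pairs {0<..r ^ N}. \<Sum>k\<in>Suc ` {..<N}. ?f i j k)"
      by (subst sum.reindex) (auto simp: o_def)
    also have "\<dots> \<le> W"
    proof (rule W)
      show "finite (index_pairs {0<..r ^ N})" by (simp add: finite_index_pairs)
    qed (auto simp: index_pairs_def)
    finally show "(\<Sum>(i, j)\<in>index_pairs {0<..r ^ N}. \<Sum>k<N.
        real r powr (- (2 / \<alpha>) * max (real (Suc k)) (log (real r) (real j)))
          * (real r powr (- (2 / p - 2 / \<alpha>) * real (Suc k)) * interaction k i j)) \<le> W" .
  qed (use assms in auto)
  moreover have "{0<..n} = {1..n}" for n :: nat by auto
  ultimately show ?thesis by simp
qed

end
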